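(* Let $\pi$ be a permutation of size $n$ with $\rho$ runs. The algorithm that builds the LRM-Tree of $\pi$, extracts from it an LRM-Partition of $\pi$ into subsequences of lengths $n_1,\dots,n_\rho$, and merges these sorted subsequences (by a Huffman-shaped merging) sorts $\pi$ using a total of $n(3+\mathcal{H}(n_1,\dots,n_\rho))$ data comparisons and $O(n+\rho\lg\rho)$ internal operations, for a total time of $O(n(1+\mathcal{H}(n_1,\dots,n_\rho)))$.
   Context: A run of $\pi$ is a maximal block of consecutive positions on which $\pi$ is increasing; $\rho=1+|\{t:1\le t<n,\ \pi_{t+1}<\pi_t\}|$. Set $\pi[0]=-\infty$, $\mathrm{PSV}(i)=\max\{j\in[0..i-1]:\pi[j]<\pi[i]\}$; the LRM-Tree $\mathcal{T}_\pi$ is the ordered tree on $\{0,\dots,n\}$ rooted at $0$ where the parent of $i\ge1$ is $\mathrm{PSV}(i)$. An LRM-Partition of $\pi$ is defined recursively: one part is the set of (non-root) nodes of a longest root-to-leaf path of $\mathcal{T}_\pi$; removing it leaves a forest, and the remaining parts are LRM-Partitions of those trees obtained the same way. Each part, in position order, is an increasing subsequence of $\pi$, and the number of parts equals the number of leaves of $\mathcal{T}_\pi$, which is $\rho$. For positive integers $n_1,\dots,n_r$ summing to $n$, the entropy is $\mathcal{H}(n_1,\dots,n_r)=\sum_{i=1}^r \frac{n_i}{n}\lg\frac{n}{n_i}$. Data comparisons are comparisons between entries of $\pi$; internal operations are all other operations.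
   Formalization: Moving an entry to the output during a merge counts as part of its data comparison, not as an internal operation; counted separately, such moves can be of order n(1+H), exceeding O(n+ρ lg ρ), e.g. for √n interleaved runs of equal length. The n(3+H) count is an upper bound. *)

theory Defs
  imports Complex_Main "HOL-Library.Multiset" "HOL-Library.Monad_Syntax"
    "HOL-Combinatorics.Permutations"
begin

definition runs :: "nat \<Rightarrow> (nat \<Rightarrow> nat) \<Rightarrow> nat" where
  "runs n \<pi> = 1 + card {t. 1 \<le> t \<and> t < n \<and> \<pi> (t + 1) < \<pi> t}"

definition entropy :: "nat list \<Rightarrow> real" where
  "entropy ns = (let n = real (sum_list ns) in \<Sum>k\<leftarrow>ns. real k / n * log 2 (n / real k))"

text \<open>The disjunct \<open>j = 0\<close> is the convention that the entry at position 0 is minus infinity.\<close>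

definition psv :: "(nat \<Rightarrow> nat) \<Rightarrow> nat \<Rightarrow> nat" where
  "psv \<pi> i = Max {j. j < i \<and> (j = 0 \<or> \<pi> j < \<pi> i)}"

lemma psv_less:
  assumes "1 \<le> i"
  shows "psv \<pi> i < i"
proof -
  let ?S = "{j. j < i \<and> (j = 0 \<or> \<pi> j < \<pi> i)}"
  have "finite ?S" by simp
  moreover have "0 \<in> ?S" using assms by simp
  ultimately have "Max ?S \<in> ?S" by (metis (no_types, lifting) Max_in empty_iff)
  then show ?thesis by (simp add: psv_def)
qed

datatype rtree = Node nat "rtree list"

function lrm_subtree :: "nat \<Rightarrow> (nat \<Rightarrow> nat) \<Rightarrow> nat \<Rightarrow> rtree" where
  "lrm_subtree n \<pi> i =
     Node i (map (lrm_subtree n \<pi>) (filter (\<lambda>j. psv \<pi> j = i) [1..<n + 1]))"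
  by auto
termination
proof (relation "measure (\<lambda>(n, \<pi>, i). n - i)", goal_cases)
  case 1
  then show ?case by simp
next
  case (2 n \<pi> i j)
  then have "1 \<le> j" "j \<le> n" "psv \<pi> j = i" by auto
  with psv_less[of j \<pi>] show ?case by simp
qed

declare lrm_subtree.simps [simp del]

definition lrm_tree :: "nat \<Rightarrow> (nat \<Rightarrow> nat) \<Rightarrow> rtree" where
  "lrm_tree n \<pi> = lrm_subtree n \<pi> 0"

text \<open>\<open>root_path t p F\<close>: \<open>p\<close> lists the nodes of a root-to-leaf path of \<open>t\<close>, and removing
  these nodes from \<open>t\<close> leaves the forest \<open>F\<close>.\<close>

inductive root_path :: "rtree \<Rightarrow> nat list \<Rightarrow> rtree list \<Rightarrow> bool" where
  leaf: "root_path (Node x []) [x] []"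
| step: "root_path t p F \<Longrightarrow> root_path (Node x (us @ t # vs)) (x # p) (us @ F @ vs)"

definition longest_root_path :: "rtree \<Rightarrow> nat list \<Rightarrow> rtree list \<Rightarrow> bool" where
  "longest_root_path t p F \<longleftrightarrow>
     root_path t p F \<and> (\<forall>q G. root_path t q G \<longrightarrow> length q \<le> length p)"

inductive tree_partition :: "rtree \<Rightarrow> nat list multiset \<Rightarrow> bool" where
  "longest_root_path t p F \<Longrightarrow> list_all2 tree_partition F Qs \<Longrightarrow>
     tree_partition t (add_mset p (sum_list Qs))"

text \<open>The root 0 of the LRM-Tree is not a position of the permutation and is dropped from its
  part; the roots of the trees of the remaining forests are positions and are kept.\<close>

definition lrm_partition :: "nat \<Rightarrow> (nat \<Rightarrow> nat) \<Rightarrow> nat list multiset \<Rightarrow> bool" where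
  "lrm_partition n \<pi> P \<longleftrightarrow>
     (\<exists>p F Qs. longest_root_path (lrm_tree n \<pi>) p F \<and> list_all2 tree_partition F Qs \<and>
        P = add_mset (tl p) (sum_list Qs))"

text \<open>Merge trees; every node stores the total length of the sequences below it.\<close>

datatype mtree = Leaf (wt: nat) "nat list" | Join (wt: nat) mtree mtree

inductive huffman_step :: "mtree multiset \<Rightarrow> mtree multiset \<Rightarrow> bool" where
  "(\<forall>c \<in># F. wt a \<le> wt c \<and> wt b \<le> wt c) \<Longrightarrow>
     huffman_step (F + {#a, b#}) (F + {#Join (wt a + wt b) a b#})"

definition huffman_tree :: "nat list multiset \<Rightarrow> mtree \<Rightarrow> bool" where
  "huffman_tree P t \<longleftrightarrow> huffman_step\<^sup>*\<^sup>* (image_mset (\<lambda>p. Leaf (length p) p) P) {#t#}"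

text \<open>Programs handle the entries of the permutation \<open>\<pi>\<close> by their positions and have no access to
  \<open>\<pi>\<close> other than \<open>Compare i j k\<close>, a data comparison that continues with \<open>k (\<pi> i < \<pi> j)\<close>.
  \<open>Step\<close> is an internal operation.\<close>

datatype 'a prog = Return 'a | Step "'a prog" | Compare nat nat "bool \<Rightarrow> 'a prog"

primrec bind_prog :: "'a prog \<Rightarrow> ('a \<Rightarrow> 'b prog) \<Rightarrow> 'b prog" where
  "bind_prog (Return x) f = f x"
| "bind_prog (Step p) f = Step (bind_prog p f)"
| "bind_prog (Compare i j k) f = Compare i j (\<lambda>b. bind_prog (k b) f)"

adhoc_overloading Monad_Syntax.bind \<rightleftharpoons> bind_prog

primrec result :: "(nat \<Rightarrow> nat) \<Rightarrow> 'a prog \<Rightarrow> 'a" where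
  "result \<pi> (Return x) = x"
| "result \<pi> (Step p) = result \<pi> p"
| "result \<pi> (Compare i j k) = result \<pi> (k (\<pi> i < \<pi> j))"

primrec comparisons :: "(nat \<Rightarrow> nat) \<Rightarrow> 'a prog \<Rightarrow> nat" where
  "comparisons \<pi> (Return x) = 0"
| "comparisons \<pi> (Step p) = comparisons \<pi> p"
| "comparisons \<pi> (Compare i j k) = Suc (comparisons \<pi> (k (\<pi> i < \<pi> j)))"

primrec internal_ops :: "(nat \<Rightarrow> nat) \<Rightarrow> 'a prog \<Rightarrow> nat" where
  "internal_ops \<pi> (Return x) = 0"
| "internal_ops \<pi> (Step p) = Suc (internal_ops \<pi> p)"
| "internal_ops \<pi> (Compare i j k) = internal_ops \<pi> (k (\<pi> i < \<pi> j))"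

definition total_time :: "(nat \<Rightarrow> nat) \<Rightarrow> 'a prog \<Rightarrow> nat" where
  "total_time \<pi> p = comparisons \<pi> p + internal_ops \<pi> p"

text \<open>In the programs below every invocation of a recursive program does a bounded amount of work
  on list cells, tree nodes and integers at most \<open>n\<close>, and is charged one \<open>Step\<close>. The one exception
  is the comparing case of \<open>merge\<close>, where moving the smaller head to the output is part of the data
  comparison; charged as internal operations, these moves alone can number in the order of
  \<open>n (1 + H)\<close>. The rest of an unexhausted list is linked to the output in one \<open>Step\<close>.\<close>

fun reverse_onto :: "rtree list \<Rightarrow> rtree list \<Rightarrow> rtree list prog" where
  "reverse_onto [] ys = Step (Return ys)"
| "reverse_onto (x # xs) ys = Step (reverse_onto xs (x # ys))"

text \<open>The stack holds the rightmost path of the tree built so far, deepest node first and the root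
  0 last; each node comes with its completed children in reverse order. No data comparison
  is made with the root.\<close>

type_synonym stack = "(nat \<times> rtree list) list"

fun pop_larger :: "nat \<Rightarrow> stack \<Rightarrow> stack prog" where
  "pop_larger i ((j, cs) # (k, ds) # st) =
     Step (Compare i j (\<lambda>less.
       if less then do {
         cs' \<leftarrow> reverse_onto cs [];
         pop_larger i ((k, Node j cs' # ds) # st)
       } else Return ((j, cs) # (k, ds) # st)))"
| "pop_larger i st = Step (Return st)"

fun close_stack :: "stack \<Rightarrow> rtree prog" where
  "close_stack ((j, cs) # (k, ds) # st) =
     Step (do {
       cs' \<leftarrow> reverse_onto cs [];
       close_stack ((k, Node j cs' # ds) # st)
     })"
| "close_stack [(j, cs)] =
     Step (do {
       cs' \<leftarrow> reverse_onto cs [];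
       Return (Node j cs')
     })"
| "close_stack [] = Step (Return (Node 0 []))"

fun scan :: "nat \<Rightarrow> nat \<Rightarrow> stack \<Rightarrow> rtree prog" where
  "scan i 0 st = Step (close_stack st)"
| "scan i (Suc m) st =
     Step (do {
       st' \<leftarrow> pop_larger i st;
       scan (Suc i) m ((i, []) # st')
     })"

definition build_lrm_tree :: "nat \<Rightarrow> rtree prog" where
  "build_lrm_tree n = scan 1 n [(0, [])]"

text \<open>\<open>split_tree t acc\<close> returns a longest root-to-leaf path of \<open>t\<close>, preceded by its length, and
  adds the parts of the remaining forest to \<open>acc\<close>; \<open>split_forest ts h p acc\<close> does so for a list
  of siblings, \<open>p\<close> being a longest path among the siblings already visited.\<close>

type_synonym parts = "(nat \<times> nat list) list"

fun split_tree :: "rtree \<Rightarrow> parts \<Rightarrow> (nat \<times> nat list \<times> parts) prog"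
  and split_forest :: "rtree list \<Rightarrow> nat \<Rightarrow> nat list \<Rightarrow> parts \<Rightarrow> (nat \<times> nat list \<times> parts) prog"
where
  "split_tree (Node x ts) acc =
     Step (do {
       (h, p, acc') \<leftarrow> split_forest ts 0 [] acc;
       Return (Suc h, x # p, acc')
     })"
| "split_forest [] h p acc = Step (Return (h, p, acc))"
| "split_forest (t # ts) h p acc =
     Step (do {
       (k, q, acc') \<leftarrow> split_tree t acc;
       if h < k then split_forest ts k q (if h = 0 then acc' else (h, p) # acc')
       else split_forest ts h p ((k, q) # acc')
     })"

definition extract_partition :: "rtree \<Rightarrow> parts prog" where
  "extract_partition t =
     do {
       (h, p, acc) \<leftarrow> split_tree t [];
       Return ((h - 1, tl p) # acc)
     }"

text \<open>Leftist heaps, ordered by weight, as the priority queue of the Huffman construction.\<close>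

datatype heap = Empty | Heap (rk: nat) (least: mtree) (left: heap) (right: heap)
  where "rk Empty = 0"

definition mk_heap :: "mtree \<Rightarrow> heap \<Rightarrow> heap \<Rightarrow> heap" where
  "mk_heap t l r =
     (if rk r \<le> rk l then Heap (Suc (rk r)) t l r else Heap (Suc (rk l)) t r l)"

fun meld :: "heap \<Rightarrow> heap \<Rightarrow> heap prog" where
  "meld Empty h = Step (Return h)"
| "meld (Heap k t l r) Empty = Step (Return (Heap k t l r))"
| "meld (Heap k t l r) (Heap k' t' l' r') =
     Step (if wt t \<le> wt t'
       then do { h \<leftarrow> meld r (Heap k' t' l' r'); Return (mk_heap t l h) }
       else do { h \<leftarrow> meld (Heap k t l r) r'; Return (mk_heap t' l' h) })"

fun enqueue :: "parts \<Rightarrow> nat \<Rightarrow> heap \<Rightarrow> (nat \<times> heap) prog" where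
  "enqueue [] m h = Step (Return (m, h))"
| "enqueue ((w, p) # ps) m h =
     Step (do {
       h' \<leftarrow> meld (Heap 1 (Leaf w p) Empty Empty) h;
       enqueue ps (Suc m) h'
     })"

fun combine :: "nat \<Rightarrow> heap \<Rightarrow> mtree prog" where
  "combine 0 h = Step (Return (least h))"
| "combine (Suc m) h =
     Step (do {
       h1 \<leftarrow> meld (left h) (right h);
       h2 \<leftarrow> meld (left h1) (right h1);
       let a = least h;
       let b = least h1;
       h3 \<leftarrow> meld (Heap 1 (Join (wt a + wt b) a b) Empty Empty) h2;
       combine m h3
     })"

definition build_huffman_tree :: "parts \<Rightarrow> mtree prog" where
  "build_huffman_tree ps =
     do {
       (m, h) \<leftarrow> enqueue ps 0 Empty;
       combine (m - 1) h
     }"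

fun merge :: "nat list \<Rightarrow> nat list \<Rightarrow> nat list prog" where
  "merge [] ys = Step (Return ys)"
| "merge (x # xs) [] = Step (Return (x # xs))"
| "merge (x # xs) (y # ys) =
     Compare x y (\<lambda>less.
       if less then do { zs \<leftarrow> merge xs (y # ys); Return (x # zs) }
       else do { zs \<leftarrow> merge (x # xs) ys; Return (y # zs) })"

fun merge_along :: "mtree \<Rightarrow> nat list prog" where
  "merge_along (Leaf w p) = Step (Return p)"
| "merge_along (Join w a b) =
     Step (do {
       xs \<leftarrow> merge_along a;
       ys \<leftarrow> merge_along b;
       merge xs ys
     })"

text \<open>The result lists the positions in increasing order of their entries.\<close>

definition lrm_sort :: "nat \<Rightarrow> nat list prog" where
  "lrm_sort n =
     do {
       t \<leftarrow> build_lrm_tree n;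
       ps \<leftarrow> extract_partition t;
       m \<leftarrow> build_huffman_tree ps;
       merge_along m
     }"

end

theory Submission imports Defs begin

text \<open>Scanning from left to right, the LRM-Tree is built with at most \<open>2n\<close> data comparisons, since every
  position is popped at most once and stops at most one sequence of pops. A node is a leaf iff a
  run ends there, so the partition has \<open>\<rho>\<close> parts, each increasing because it follows a path of
  previous smaller values. Merging costs at most the weighted path length of the Huffman tree. An
  exchange argument bounds this by \<open>\<Sum> n\<^sub>i l\<^sub>i\<close> for all lengths \<open>l\<^sub>i\<close> satisfying Kraft's inequality, and
  the choice \<open>l\<^sub>i = \<lceil>lg (n / n\<^sub>i)\<rceil>\<close> gives \<open>n (1 + H)\<close>. The heap operations account for the term
  \<open>\<rho> lg \<rho>\<close>, which is at most \<open>n (1 + H)\<close> because \<open>k lg (n / k) + k \<ge> lg n\<close> for every part length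
  \<open>k \<ge> 1\<close>.\<close>

lemma result_bind [simp]: "result \<pi> (bind_prog p f) = result \<pi> (f (result \<pi> p))"
  by (induction p) auto

lemma comparisons_bind [simp]:
  "comparisons \<pi> (bind_prog p f) = comparisons \<pi> p + comparisons \<pi> (f (result \<pi> p))"
  by (induction p) auto

lemma internal_ops_bind [simp]:
  "internal_ops \<pi> (bind_prog p f) = internal_ops \<pi> p + internal_ops \<pi> (f (result \<pi> p))"
  by (induction p) auto

subsection \<open>Building the LRM-Tree\<close>

lemma reverse_onto_simps [simp]:
  "result \<pi> (reverse_onto xs ys) = rev xs @ ys"
  "comparisons \<pi> (reverse_onto xs ys) = 0"
  "internal_ops \<pi> (reverse_onto xs ys) = length xs + 1"
  by (induction xs ys rule: reverse_onto.induct) auto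

section \<open>Preorder of the tree under construction\<close>

fun labels :: "rtree \<Rightarrow> nat list" where
  "labels (Node x ts) = x # concat (map labels ts)"

text \<open>Preorder of the tree that closing the stack would produce. The deepest node is the head
  of the stack, so the rest is listed first.\<close>

fun stack_labels :: "stack \<Rightarrow> nat list" where
  "stack_labels [] = []"
| "stack_labels ((j, cs) # st) = stack_labels st @ j # concat (map labels (rev cs))"

lemma stack_labels_pop_larger:
  "stack_labels (result \<pi> (pop_larger i st)) = stack_labels st"
  by (induction i st rule: pop_larger.induct) auto

lemma labels_close_stack:
  "st \<noteq> [] \<Longrightarrow> labels (result \<pi> (close_stack st)) = stack_labels st"
  by (induction st rule: close_stack.induct) auto

lemma labels_scan:
  "st \<noteq> [] \<Longrightarrow> labels (result \<pi> (scan i m st)) = stack_labels st @ [i..<i + m]"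
proof (induction i m st rule: scan.induct)
  case (2 i m st)
  have "[i..<i + Suc m] = i # [Suc i..<Suc i + m]"
    by (simp add: upt_conv_Cons)
  then show ?case
    using 2 by (simp add: stack_labels_pop_larger)
qed (simp add: labels_close_stack)

text \<open>Pops preserve the preorder and each push appends the next position. This later yields
  the number of nodes and the set of positions in the tree.\<close>

lemma labels_build_lrm_tree: "labels (result \<pi> (build_lrm_tree n)) = [0..<n + 1]"
  by (simp add: build_lrm_tree_def labels_scan upt_conv_Cons)

text \<open>Amortisation by the height of the stack: every comparison pops a node, except the one
  that stops the loop.\<close>

lemma comparisons_pop_larger:
  "st \<noteq> [] \<Longrightarrow>
     comparisons \<pi> (pop_larger i st) + length (result \<pi> (pop_larger i st)) \<le> length st + 1"
  by (induction i st rule: pop_larger.induct) auto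

lemma comparisons_close_stack [simp]: "comparisons \<pi> (close_stack st) = 0"
  by (induction st rule: close_stack.induct) auto

text \<open>Per position, 2 pays for the stopping comparison and for the push, the credit for a
  later pop. The root is never popped, hence the 1 on the left.\<close>

lemma comparisons_scan:
  "st \<noteq> [] \<Longrightarrow> comparisons \<pi> (scan i m st) + 1 \<le> 2 * m + length st"
proof (induction i m st rule: scan.induct)
  case (2 i m st)
  show ?case
    using comparisons_pop_larger[of st \<pi> i] "2.prems" "2.IH"[of "result \<pi> (pop_larger i st)"] by simp
qed (simp add: Suc_leI)

lemma comparisons_build_lrm_tree: "comparisons \<pi> (build_lrm_tree n) \<le> 2 * n"
  using comparisons_scan[of "[(0, [])]" \<pi> 1 n] by (simp add: build_lrm_tree_def)

text \<open>Potential for the amortised analysis: popping a node pays for reversing its children, and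
  makes it a child itself.\<close>

definition stack_potential :: "stack \<Rightarrow> nat" where
  "stack_potential st = (\<Sum>(j, cs)\<leftarrow>st. length cs + 3)"

lemma stack_potential_simps [simp]:
  "stack_potential [] = 0"
  "stack_potential ((j, cs) # st) = length cs + 3 + stack_potential st"
  by (simp_all add: stack_potential_def)

text \<open>The summand 3 in the potential is what one pop needs: \<open>length cs + 2\<close>
  operations for the call and the reversal, and 1 for the new child of the node below. The final 1
  pays for the call that stops.\<close>

lemma internal_ops_pop_larger:
  "internal_ops \<pi> (pop_larger i st) + stack_potential (result \<pi> (pop_larger i st))
     \<le> stack_potential st + 1"
  by (induction i st rule: pop_larger.induct) auto

lemma internal_ops_close_stack:
  "internal_ops \<pi> (close_stack st) \<le> stack_potential st + 1"
  by (induction st rule: close_stack.induct) auto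

text \<open>The 5 per position is one \<open>Step\<close> of the scan, one of the last call of
  \<open>pop_larger\<close>, and 3 for the potential of the new node.\<close>

lemma internal_ops_scan:
  "internal_ops \<pi> (scan i m st) \<le> 5 * m + stack_potential st + 2"
proof (induction i m st rule: scan.induct)
  case (2 i m st)
  show ?case
    using internal_ops_pop_larger[of \<pi> i st] "2.IH"[of "result \<pi> (pop_larger i st)"] by simp
qed (use internal_ops_close_stack in force)

lemma internal_ops_build_lrm_tree: "internal_ops \<pi> (build_lrm_tree n) \<le> 5 * n + 5"
  using internal_ops_scan[of \<pi> 1 n "[(0, [])]"] by (simp add: build_lrm_tree_def)

section \<open>Previous smaller values and correctness of the scan\<close>

context
  fixes n :: nat and \<pi> :: "nat \<Rightarrow> nat"
  assumes perm: "\<pi> permutes {1..n}"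
begin

text \<open>A permutation of \<open>{1..n}\<close> fixes 0, and entries at positive positions are
  positive; thus position 0 behaves as if it held minus infinity.\<close>

lemma perm_zero: "\<pi> 0 = 0"
  using perm by (simp add: permutes_def)

lemma perm_eq_iff: "\<pi> i = \<pi> j \<longleftrightarrow> i = j"
  using permutes_inj[OF perm] by (auto dest: injD)

lemma perm_pos: "1 \<le> i \<Longrightarrow> 0 < \<pi> i"
  using perm_eq_iff[of i 0] perm_zero by simp

lemma psv_set_eq:
  "1 \<le> i \<Longrightarrow> {j. j < i \<and> (j = 0 \<or> \<pi> j < \<pi> i)} = {j. j < i \<and> \<pi> j < \<pi> i}"
  using perm_pos[of i] perm_zero by auto

lemma perm_psv_less:
  assumes "1 \<le> i"
  shows "\<pi> (psv \<pi> i) < \<pi> i"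
proof -
  have "0 \<in> {j. j < i \<and> \<pi> j < \<pi> i}" using perm_pos[OF assms] perm_zero assms by auto
  then have "Max {j. j < i \<and> \<pi> j < \<pi> i} \<in> {j. j < i \<and> \<pi> j < \<pi> i}"
    by (intro Max_in) auto
  then show ?thesis
    by (simp add: psv_def psv_set_eq[OF assms])
qed

lemma perm_above_psv:
  assumes "psv \<pi> i < c" "c < i"
  shows "\<pi> i < \<pi> c"
proof (rule ccontr)
  assume "\<not> \<pi> i < \<pi> c"
  then have "\<pi> c < \<pi> i" using perm_eq_iff[of c i] assms by auto
  then have "c \<le> psv \<pi> i"
    unfolding psv_def using assms by (intro Max_ge) auto
  with assms show False by simp
qed

lemma psv_eqI:
  assumes "j < i" "\<pi> j < \<pi> i" "\<And>c. j < c \<Longrightarrow> c < i \<Longrightarrow> \<pi> i < \<pi> c"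
  shows "psv \<pi> i = j"
proof -
  have "1 \<le> i" using assms(1) by simp
  then have "\<pi> (psv \<pi> i) < \<pi> i" "psv \<pi> i < i"
    by (auto intro: perm_psv_less psv_less)
  then show ?thesis
    using assms perm_above_psv[of i j] by (meson linorder_neqE_nat order_less_asym)
qed

text \<open>The subtrees are those of the final tree, while the bound \<open>b\<close> cuts off
  children not yet completed; \<open>b = n + 1\<close> gives them all.\<close>

definition kids :: "nat \<Rightarrow> nat \<Rightarrow> rtree list" where
  "kids j b = map (lrm_subtree n \<pi>) (filter (\<lambda>c. psv \<pi> c = j) [1..<b])"

lemma lrm_subtree_eq: "lrm_subtree n \<pi> j = Node j (kids j (n + 1))"
  by (subst lrm_subtree.simps) (simp add: kids_def)

lemma upt_one_split: "1 \<le> a \<Longrightarrow> a \<le> b \<Longrightarrow> [1..<b] = [1..<a] @ [a..<b]"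
  using upt_add_eq_append[of 1 a "b - a"] by simp

text \<open>A later child \<open>c\<close> of the parent of \<open>j\<close> would have its previous
  smaller value before \<open>j\<close>, forcing \<open>\<pi> c < \<pi> j\<close>.\<close>

lemma kids_extend:
  assumes "1 \<le> j" "j < b" "\<And>c. j < c \<Longrightarrow> c < b \<Longrightarrow> \<pi> j < \<pi> c"
  shows "kids (psv \<pi> j) b = kids (psv \<pi> j) j @ [lrm_subtree n \<pi> j]"
proof -
  have "psv \<pi> c \<noteq> psv \<pi> j" if "c \<in> set [Suc j..<b]" for c
  proof
    assume eq: "psv \<pi> c = psv \<pi> j"
    have "psv \<pi> c < j" using psv_less[OF assms(1)] eq by simp
    then have "\<pi> c < \<pi> j" using that by (intro perm_above_psv) auto
    moreover have "\<pi> j < \<pi> c" using assms(3) that by simp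
    ultimately show False by simp
  qed
  then have "filter (\<lambda>c. psv \<pi> c = psv \<pi> j) [Suc j..<b] = []"
    by (simp add: filter_empty_conv)
  moreover have "[1..<b] = [1..<j] @ j # [Suc j..<b]"
    using upt_one_split[of j b] assms(1,2) by (simp add: upt_conv_Cons)
  ultimately show ?thesis
    unfolding kids_def by simp
qed

text \<open>A smaller entry at \<open>i\<close> closes \<open>j\<close>: a child \<open>c\<close> of
  \<open>j\<close> with \<open>i \<le> c\<close> would need
  \<open>\<pi> j < \<pi> c \<le> \<pi> i\<close>, since \<open>i\<close> lies between
  \<open>j\<close> and \<open>c\<close> or is \<open>c\<close>.\<close>

lemma kids_complete:
  assumes "\<pi> i < \<pi> j" "1 \<le> i" "j < i" "i \<le> n"
  shows "kids j (n + 1) = kids j i"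
proof -
  have "psv \<pi> c \<noteq> j" if "c \<in> set [i..<n + 1]" for c
  proof
    assume eq: "psv \<pi> c = j"
    have c: "i \<le> c" "1 \<le> c" using that assms(2) by auto
    have "\<pi> j < \<pi> c" using perm_psv_less[OF c(2)] eq by simp
    moreover have "\<pi> c \<le> \<pi> i"
      using perm_above_psv[of c i] eq assms(3) c by (cases "i = c") auto
    ultimately show False using assms(1) by simp
  qed
  then have "filter (\<lambda>c. psv \<pi> c = j) [i..<n + 1] = []"
    by (auto simp: filter_empty_conv)
  then show ?thesis
    unfolding kids_def using upt_one_split[of i "n + 1"] assms by simp
qed

text \<open>\<open>valid_stack b st\<close>: the stack of the scan once all positions below \<open>b\<close> are processed. The
  subtrees completed by then are those of the final tree.\<close>

fun valid_stack :: "nat \<Rightarrow> stack \<Rightarrow> bool" where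
  "valid_stack b [] = False"
| "valid_stack b ((j, cs) # st) \<longleftrightarrow>
     j < b \<and> cs = rev (kids j b) \<and> (\<forall>c. j < c \<longrightarrow> c < b \<longrightarrow> \<pi> j < \<pi> c) \<and>
     (if st = [] then j = 0 else 1 \<le> j \<and> fst (hd st) = psv \<pi> j \<and> valid_stack j st)"

text \<open>Popping and closing share this step. Entries after \<open>j\<close> stay above
  \<open>\<pi> k\<close> because they exceed \<open>\<pi> j\<close>, which exceeds
  \<open>\<pi> k\<close>.\<close>

lemma valid_stack_pop:
  assumes "valid_stack b ((j, cs) # (k, ds) # st)"
  shows "valid_stack b ((k, lrm_subtree n \<pi> j # ds) # st)"
proof -
  have j: "1 \<le> j" "j < b" "\<And>c. j < c \<Longrightarrow> c < b \<Longrightarrow> \<pi> j < \<pi> c" "psv \<pi> j = k"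
    and k: "k < j" "ds = rev (kids k j)" "\<And>c. k < c \<Longrightarrow> c < j \<Longrightarrow> \<pi> k < \<pi> c"
    using assms by auto
  have "kids k b = kids k j @ [lrm_subtree n \<pi> j]"
    using kids_extend[of j b] j by simp
  moreover have "\<pi> k < \<pi> c" if "k < c" "c < b" for c
    using that k(3)[of c] j(3)[of c] perm_psv_less[OF j(1)] j(4)
    by (metis linorder_neqE_nat order_less_trans)
  ultimately show ?thesis
    using assms k j by auto
qed

text \<open>The last hypothesis is the loop invariant: everything between the top of the stack and
  \<open>i\<close> exceeds \<open>\<pi> i\<close>. A pop extends it down to the next node; when the
  loop stops, it makes the top the previous smaller value of \<open>i\<close>.\<close>

lemma valid_stack_pop_larger:
  assumes "valid_stack i st" "1 \<le> i" "i \<le> n"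
    and "\<And>c. fst (hd st) < c \<Longrightarrow> c < i \<Longrightarrow> \<pi> i < \<pi> c"
  shows "valid_stack i (result \<pi> (pop_larger i st)) \<and>
    fst (hd (result \<pi> (pop_larger i st))) = psv \<pi> i"
  using assms
proof (induction i st rule: pop_larger.induct)
  case (1 i j cs k ds st)
  have j: "1 \<le> j" "j < i" "psv \<pi> j = k" "cs = rev (kids j i)"
    using "1.prems"(1) by auto
  show ?case
  proof (cases "\<pi> i < \<pi> j")
    case True
    have tree: "Node j (rev cs) = lrm_subtree n \<pi> j"
      using kids_complete[OF True] j "1.prems"(2,3) by (simp add: lrm_subtree_eq)
    have "valid_stack i ((k, Node j (rev cs) # ds) # st)"
      unfolding tree by (rule valid_stack_pop[OF "1.prems"(1)])
    moreover have "\<pi> i < \<pi> c" if "k < c" "c < i" for c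
      using that "1.prems"(4)[of c] True perm_above_psv[of j c] j(3)
      by (metis fst_conv linorder_neqE_nat list.sel(1) order_less_trans)
    ultimately show ?thesis
      using "1.IH"[OF True, of "rev cs"] "1.prems"(2,3) True
      by (simp del: valid_stack.simps)
  next
    case False
    then have "\<pi> j < \<pi> i" using perm_eq_iff[of i j] j(2) by auto
    then have "psv \<pi> i = j" using "1.prems"(4) j(2) by (intro psv_eqI) auto
    then show ?thesis using False "1.prems"(1) by (simp del: valid_stack.simps)
  qed
next
  case ("2_2" i e)
  obtain j cs where e: "e = (j, cs)" by (cases e)
  have "psv \<pi> i = 0"
    using "2_2.prems" perm_pos[of i] perm_zero e by (intro psv_eqI) auto
  then show ?case using "2_2.prems" e by auto
qed simp

lemma result_close_stack:
  "valid_stack (n + 1) st \<Longrightarrow> result \<pi> (close_stack st) = lrm_tree n \<pi>"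
proof (induction st rule: close_stack.induct)
  case (1 j cs k ds st)
  have "Node j (rev cs) = lrm_subtree n \<pi> j"
    using "1.prems" by (simp add: lrm_subtree_eq)
  then show ?case
    using "1.IH"[of "rev cs"] valid_stack_pop[OF "1.prems"] by (simp del: valid_stack.simps)
next
  case (2 j cs)
  then show ?case by (simp add: lrm_tree_def lrm_subtree_eq)
qed simp

text \<open>The top is always the position scanned last, so the loop invariant of
  \<open>pop_larger\<close> holds vacuously at the start of each round.\<close>

lemma result_scan:
  assumes "valid_stack i st" "fst (hd st) = i - 1" "1 \<le> i" "i + m = n + 1"
  shows "result \<pi> (scan i m st) = lrm_tree n \<pi>"
  using assms
proof (induction i m st rule: scan.induct)
  case (1 i st)
  then show ?case using result_close_stack by simp
next
  case (2 i m st)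
  let ?st = "result \<pi> (pop_larger i st)"
  have pop: "valid_stack i ?st" "fst (hd ?st) = psv \<pi> i"
    using valid_stack_pop_larger[of i st] "2.prems" by auto
  have "filter (\<lambda>c. psv \<pi> c = i) [1..<Suc i] = []"
    using psv_less[of _ \<pi>] by (fastforce simp: filter_empty_conv simp del: upt_Suc)
  then have "kids i (Suc i) = []" by (simp only: kids_def list.map)
  then have "valid_stack (Suc i) ((i, []) # ?st)"
    using pop "2.prems"(3) by auto
  then show ?case
    using "2.IH" "2.prems" by simp
qed

lemma result_build_lrm_tree: "result \<pi> (build_lrm_tree n) = lrm_tree n \<pi>"
  unfolding build_lrm_tree_def by (rule result_scan) (auto simp: kids_def)

text \<open>If \<open>i\<close> has any child \<open>c\<close>, then \<open>i + 1\<close> is a child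
  too, because no entry strictly between \<open>i\<close> and \<open>c\<close> is below
  \<open>\<pi> c\<close>. Thus a position is a leaf exactly where a run ends.\<close>

lemma kids_empty_iff:
  assumes "1 \<le> i" "i \<le> n"
  shows "kids i (n + 1) = [] \<longleftrightarrow> i = n \<or> \<pi> (i + 1) < \<pi> i"
proof -
  have "psv \<pi> (i + 1) = i" if "i < c" "psv \<pi> c = i" for c
  proof (rule psv_eqI)
    have "\<pi> i < \<pi> c" using perm_psv_less[of c] that by simp
    then show "\<pi> i < \<pi> (i + 1)"
      using perm_above_psv[of c "i + 1"] that by (cases "c = i + 1") auto
  qed auto
  moreover have "i < c" if "1 \<le> c" "psv \<pi> c = i" for c
    using psv_less[OF that(1)] that(2) by blast
  ultimately have "kids i (n + 1) = [] \<longleftrightarrow> i = n \<or> psv \<pi> (i + 1) \<noteq> i"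
    using assms unfolding kids_def
    by (auto simp: filter_empty_conv simp del: upt_Suc)
       (metis Suc_leI atLeastLessThan_iff le_SucI le_neq_implies_less less_Suc_eq_le not_less_eq_eq)+
  moreover have "psv \<pi> (i + 1) = i \<longleftrightarrow> \<pi> i < \<pi> (i + 1)"
    using perm_psv_less[of "i + 1"] by (auto intro: psv_eqI)
  ultimately show ?thesis
    using perm_eq_iff[of i "i + 1"] by auto
qed

end

subsection \<open>Extracting the LRM-Partition\<close>

fun leaves :: "rtree \<Rightarrow> nat" where
  "leaves (Node x ts) = (if ts = [] then 1 else \<Sum>t\<leftarrow>ts. leaves t)"

section \<open>Longest root paths when a sibling is appended\<close>

inductive_cases root_path_NodeE: "root_path (Node x ts) p F"

lemma root_path_nonempty: "root_path t p F \<Longrightarrow> p \<noteq> []"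
  by (cases rule: root_path.cases) auto

text \<open>The condition \<open>p \<noteq> []\<close> excludes a node without children, whose path
  \<open>[x]\<close> would no longer end in a leaf.\<close>

lemma root_path_snoc_old:
  "root_path (Node x us) (x # p) G \<Longrightarrow> p \<noteq> [] \<Longrightarrow> root_path (Node x (us @ [t])) (x # p) (G @ [t])"
  by (erule root_path_NodeE) (auto intro: root_path.step)

lemma root_path_snoc_new:
  "root_path t q F \<Longrightarrow> root_path (Node x (us @ [t])) (x # q) (us @ F)"
  using root_path.step[of t q F x us "[]"] by simp

lemma root_path_snoc_cases:
  assumes "root_path (Node x (us @ [t])) r H"
  obtains G where "root_path (Node x us) r G" | q F where "r = x # q" "root_path t q F"
  using assms
proof (cases rule: root_path.cases)
  case (step t' p F us' vs)
  show ?thesis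
  proof (cases vs rule: rev_cases)
    case Nil
    then show ?thesis using step that(2) by auto
  next
    case (snoc ws w)
    then show ?thesis using step that(1)[of "us' @ F @ ws"] by (auto intro: root_path.step)
  qed
qed auto

lemma longest_root_path_snoc_old:
  assumes "longest_root_path (Node x us) (x # p) G" "longest_root_path t q F" "length q \<le> length p"
  shows "longest_root_path (Node x (us @ [t])) (x # p) (G @ [t])"
proof -
  have "q \<noteq> []" using assms(2) root_path_nonempty unfolding longest_root_path_def by blast
  then have "p \<noteq> []" using assms(3) by auto
  then show ?thesis
    using assms unfolding longest_root_path_def
    by (auto intro: root_path_snoc_old elim!: root_path_snoc_cases dest: order_trans)
qed

lemma longest_root_path_snoc_new:
  assumes "longest_root_path (Node x us) (x # p) G" "longest_root_path t q F" "length p < length q"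
  shows "longest_root_path (Node x (us @ [t])) (x # q) (us @ F)"
  using assms unfolding longest_root_path_def
  by (auto intro: root_path_snoc_new elim!: root_path_snoc_cases)

lemma longest_root_path_leaf: "longest_root_path (Node x []) [x] []"
  unfolding longest_root_path_def by (auto intro: root_path.leaf elim: root_path_NodeE)

text \<open>Below \<open>x\<close> the longest path continues as a longest path of one child
  \<open>t\<close>, so adding \<open>p\<close> to the parts of \<open>G\<close> completes a
  partition of the forest \<open>us\<close>. This serves when a longer path replaces
  \<open>p\<close>, which then becomes a part of its own.\<close>

lemma forest_partition_with_path:
  assumes "longest_root_path (Node x us) (x # p) G" "list_all2 tree_partition G Qs" "us \<noteq> []"
  obtains Rs where "list_all2 tree_partition us Rs" "sum_list Rs = add_mset p (sum_list Qs)"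
proof -
  have "root_path (Node x us) (x # p) G"
    using assms(1) by (simp add: longest_root_path_def)
  then obtain t F vs ws where t: "us = vs @ t # ws" "G = vs @ F @ ws" "root_path t p F"
    using assms(3) by (cases rule: root_path_NodeE) auto
  have "length q \<le> length p" if "root_path t q H" for q H
    using root_path.step[OF that, of x vs ws] assms(1) t(1) unfolding longest_root_path_def by fastforce
  then have longest: "longest_root_path t p F"
    using t(3) by (auto simp: longest_root_path_def)
  obtain Q1 Q2 Q3 where Q: "Qs = Q1 @ Q2 @ Q3" "list_all2 tree_partition vs Q1"
      "list_all2 tree_partition F Q2" "list_all2 tree_partition ws Q3"
    using assms(2) unfolding t(2) by (auto simp: list_all2_append1)
  have "tree_partition t (add_mset p (sum_list Q2))"
    using longest Q(3) by (rule tree_partition.intros)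
  then have "list_all2 tree_partition us (Q1 @ add_mset p (sum_list Q2) # Q3)"
    using Q t(1) by (auto intro: list_all2_appendI)
  then show thesis
    by (rule that) (simp add: Q(1) ac_simps)
qed

definition parts_ok :: "parts \<Rightarrow> bool" where
  "parts_ok ps \<longleftrightarrow> (\<forall>(w, p) \<in> set ps. w = length p)"

lemma parts_ok_simps [simp]:
  "parts_ok []" "parts_ok ((w, p) # ps) \<longleftrightarrow> w = length p \<and> parts_ok ps"
  by (auto simp: parts_ok_def)

text \<open>For a forest, the visited siblings \<open>us\<close> hang below an arbitrary root
  \<open>x\<close>, so that a longest path among them is again a longest root path.
  \<open>Rs\<close> stands for the parts emitted for them so far; adding its sum on the left avoids
  a multiset difference.\<close>

lemma split_correct:
  "parts_ok acc \<Longrightarrow> result \<pi> (split_tree t acc) = (h, p, acc') \<Longrightarrow>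
     h = length p \<and> parts_ok acc' \<and> (\<exists>F Qs. longest_root_path t p F \<and>
       list_all2 tree_partition F Qs \<and> mset (map snd acc') = sum_list Qs + mset (map snd acc))"
  "parts_ok bcc \<Longrightarrow> result \<pi> (split_forest ts k q bcc) = (h, p, acc') \<Longrightarrow> k = length q \<Longrightarrow>
     longest_root_path (Node x us) (x # q) G \<Longrightarrow> list_all2 tree_partition G Rs \<Longrightarrow>
     h = length p \<and> parts_ok acc' \<and> (\<exists>F Qs. longest_root_path (Node x (us @ ts)) (x # p) F \<and>
       list_all2 tree_partition F Qs \<and>
       mset (map snd acc') + sum_list Rs = sum_list Qs + mset (map snd bcc))"
proof (induction t acc and ts k q bcc arbitrary: h p acc' and h p acc' x us G Rs
    rule: split_tree_split_forest.induct)
  case (1 y ts acc)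
  obtain h0 p0 where r: "result \<pi> (split_forest ts 0 [] acc) = (h0, p0, acc')"
      "h = Suc h0" "p = y # p0"
    using "1.prems"(2) by (auto split: prod.splits)
  show ?case
    using "1.IH"[OF "1.prems"(1) r(1) _ longest_root_path_leaf[of y], of "[]"] r(2,3) by simp
next
  case (2 h p acc)
  then show ?case by auto
next
  case (3 t ts k q bcc)
  obtain l s ccc where t: "result \<pi> (split_tree t bcc) = (l, s, ccc)"
    by (cases "result \<pi> (split_tree t bcc)") auto
  obtain F Qs where F: "longest_root_path t s F" "list_all2 tree_partition F Qs"
      "mset (map snd ccc) = sum_list Qs + mset (map snd bcc)" "l = length s" "parts_ok ccc"
    using "3.IH"(1)[OF "3.prems"(1) t] by auto
  show ?case
  proof (cases "k < l")
    case True
    let ?acc = "if k = 0 then ccc else (k, q) # ccc"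
    have r: "result \<pi> (split_forest ts l s ?acc) = (h, p, acc')"
      using "3.prems"(2) t True by (auto split: if_splits)
    have new: "longest_root_path (Node x (us @ [t])) (x # s) (us @ F)"
      using longest_root_path_snoc_new[OF "3.prems"(4) F(1)] True F(4) "3.prems"(3) by simp
    \<comment> \<open>Partition of the visited siblings once their path is superseded. With none
      visited there is no path to store, which is the test \<open>k = 0\<close>; otherwise the old
      path \<open>q\<close> becomes a part.\<close>
    have "\<exists>Us. list_all2 tree_partition us Us \<and>
        mset (map snd ?acc) + sum_list Rs = sum_list Us + mset (map snd ccc)"
    proof (cases "us = []")
      case True
      then have "q = []" "G = []"
        using "3.prems"(4) unfolding longest_root_path_def by (auto elim: root_path_NodeE)
      then show ?thesis using True "3.prems"(3,5) by simp
    next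
      case False
      have "q \<noteq> []"
        using "3.prems"(4) False unfolding longest_root_path_def
        by (auto elim!: root_path_NodeE dest: root_path_nonempty)
      then have acc: "?acc = (k, q) # ccc" using "3.prems"(3) by simp
      obtain Us where Us: "list_all2 tree_partition us Us" "sum_list Us = add_mset q (sum_list Rs)"
        using forest_partition_with_path[OF "3.prems"(4,5) False] .
      show ?thesis
        unfolding acc using Us by (intro exI[of _ Us]) (simp add: ac_simps)
    qed
    then obtain Us where Us: "list_all2 tree_partition us Us"
        "mset (map snd ?acc) + sum_list Rs = sum_list Us + mset (map snd ccc)" by blast
    have "parts_ok ?acc" using F(5) "3.prems"(3) by simp
    moreover have "list_all2 tree_partition (us @ F) (Us @ Qs)"
      using Us(1) F(2) by (rule list_all2_appendI)
    ultimately have "h = length p \<and> parts_ok acc' \<and>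
       (\<exists>F' Qs'. longest_root_path (Node x ((us @ [t]) @ ts)) (x # p) F' \<and>
          list_all2 tree_partition F' Qs' \<and>
          mset (map snd acc') + sum_list (Us @ Qs) = sum_list Qs' + mset (map snd ?acc))"
      using "3.IH"(2)[OF True _ r F(4) new] by blast
    moreover have "mset (map snd acc') + sum_list Rs = S + mset (map snd bcc)"
      if "mset (map snd acc') + sum_list (Us @ Qs) = S + mset (map snd ?acc)" for S
    proof -
      have "mset (map snd acc') + sum_list Rs + sum_list (Us @ Qs) =
          (mset (map snd acc') + sum_list (Us @ Qs)) + sum_list Rs"
        by (simp only: ac_simps)
      also have "\<dots> = S + (sum_list Us + mset (map snd ccc))"
        unfolding that by (simp only: Us(2) add.assoc)
      also have "\<dots> = S + mset (map snd bcc) + sum_list (Us @ Qs)"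
        by (simp only: F(3) sum_list_append ac_simps)
      finally show ?thesis by simp
    qed
    ultimately show ?thesis by auto
  next
    case False
    have r: "result \<pi> (split_forest ts k q ((l, s) # ccc)) = (h, p, acc')"
      using "3.prems"(2) t False by auto
    have old: "longest_root_path (Node x (us @ [t])) (x # q) (G @ [t])"
      using longest_root_path_snoc_old[OF "3.prems"(4) F(1)] False F(4) "3.prems"(3) by simp
    have "tree_partition t (add_mset s (sum_list Qs))"
      using F(1,2) by (rule tree_partition.intros)
    then have "list_all2 tree_partition (G @ [t]) (Rs @ [add_mset s (sum_list Qs)])"
      using "3.prems"(5) by (auto intro: list_all2_appendI)
    moreover have "parts_ok ((l, s) # ccc)" using F(4,5) by simp
    ultimately have "h = length p \<and> parts_ok acc' \<and>
       (\<exists>F' Qs'. longest_root_path (Node x ((us @ [t]) @ ts)) (x # p) F' \<and>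
          list_all2 tree_partition F' Qs' \<and>
          mset (map snd acc') + sum_list (Rs @ [add_mset s (sum_list Qs)])
            = sum_list Qs' + mset (map snd ((l, s) # ccc)))"
      using "3.IH"(3)[OF False _ r "3.prems"(3) old] by blast
    then show ?thesis
      using F(3) by (auto simp: ac_simps)
  qed
qed

lemma comparisons_split [simp]:
  "comparisons \<pi> (split_tree t acc) = 0"
  "comparisons \<pi> (split_forest ts h p bcc) = 0"
  by (induction t acc and ts h p bcc rule: split_tree_split_forest.induct)
    (auto split: prod.splits)

text \<open>Each node accounts for three calls: \<open>split_tree\<close> on it,
  \<open>split_forest\<close> at its place among its siblings, and \<open>split_forest\<close> at
  the end of its child list. The root of \<open>t\<close> lacks the second; a forest has one more
  call at its own end.\<close>

lemma internal_ops_split: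
  "internal_ops \<pi> (split_tree t acc) + 1 = 3 * length (labels t)"
  "internal_ops \<pi> (split_forest ts h p bcc) = 3 * length (concat (map labels ts)) + 1"
proof (induction t acc and ts h p bcc rule: split_tree_split_forest.induct)
  case (3 t ts h p acc)
  obtain k q acc' where t: "result \<pi> (split_tree t acc) = (k, q, acc')"
    by (cases "result \<pi> (split_tree t acc)") auto
  show ?case
  proof (cases "h < k")
    case True
    then show ?thesis
      using "3.IH"(1) "3.IH"(2)[of k q acc'] t by auto
  next
    case False
    then show ?thesis
      using "3.IH"(1) "3.IH"(3)[of k q acc'] t by auto
  qed
qed (auto split: prod.splits)

lemma comparisons_extract_partition [simp]: "comparisons \<pi> (extract_partition t) = 0"
  by (auto simp: extract_partition_def split: prod.splits)

lemma internal_ops_extract_partition: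
  "internal_ops \<pi> (extract_partition t) + 1 = 3 * length (labels t)"
  using internal_ops_split(1)[of \<pi> t "[]"] by (auto simp: extract_partition_def split: prod.splits)

lemma extract_partition_correct:
  obtains p F Qs where "longest_root_path t p F" "list_all2 tree_partition F Qs"
    "mset (map snd (result \<pi> (extract_partition t))) = add_mset (tl p) (sum_list Qs)"
    "parts_ok (result \<pi> (extract_partition t))"
proof -
  obtain h p acc where r: "result \<pi> (split_tree t []) = (h, p, acc)"
    by (cases "result \<pi> (split_tree t [])") auto
  show thesis
    using split_correct(1)[OF _ r] r that by (auto simp: extract_partition_def)
qed

section \<open>Nodes, leaves and order of the parts\<close>

lemma root_path_labels:
  "root_path t p F \<Longrightarrow> mset (labels t) = mset p + (\<Sum>t\<leftarrow>F. mset (labels t))"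
  by (induction rule: root_path.induct) (auto simp: mset_concat comp_def)

text \<open>A path takes away one leaf and the trees left over keep theirs, so each part will
  account for exactly one leaf.\<close>

lemma root_path_leaves:
  "root_path t p F \<Longrightarrow> leaves t = 1 + (\<Sum>t\<leftarrow>F. leaves t)"
  by (induction rule: root_path.induct) auto

fun increasing_tree :: "(nat \<Rightarrow> nat) \<Rightarrow> rtree \<Rightarrow> bool" where
  "increasing_tree \<pi> (Node x ts) \<longleftrightarrow>
     (\<forall>t\<in>set ts. \<pi> x < \<pi> (hd (labels t)) \<and> increasing_tree \<pi> t)"

lemma root_path_increasing:
  "root_path t p F \<Longrightarrow> increasing_tree \<pi> t \<Longrightarrow>
     hd p = hd (labels t) \<and> sorted (map \<pi> p) \<and> (\<forall>t\<in>set F. increasing_tree \<pi> t)"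
proof (induction rule: root_path.induct)
  case (step t p F x us vs)
  then obtain y q where p: "p = y # q"
    using root_path_nonempty neq_Nil_conv by metis
  have "\<pi> x < \<pi> y" using step p by auto
  then show ?case using step p by fastforce
qed auto

lemma tree_partition_properties:
  assumes "tree_partition t Q"
  shows "(\<Sum>p\<in>#Q. mset p) = mset (labels t)" "size Q = leaves t" "[] \<notin># Q"
    "increasing_tree \<pi> t \<Longrightarrow> \<forall>p\<in>#Q. sorted (map \<pi> p)"
  using assms
proof (induction rule: tree_partition.induct)
  case (1 t p F Qs)
  have path: "root_path t p F" using 1 by (simp add: longest_root_path_def)
  {
    case 1
    have "(\<Sum>p\<in>#sum_list Qs. mset p) = (\<Sum>t\<leftarrow>F. mset (labels t))"
      using \<open>list_all2 _ F Qs\<close> by (induction rule: list_all2_induct) auto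
    then show ?case using root_path_labels[OF path] by simp
  next
    case 2
    have "size (sum_list Qs) = (\<Sum>t\<leftarrow>F. leaves t)"
      using \<open>list_all2 _ F Qs\<close> by (induction rule: list_all2_induct) auto
    then show ?case using root_path_leaves[OF path] by simp
  next
    case 3
    have "[] \<notin># sum_list Qs"
      using \<open>list_all2 _ F Qs\<close> by (induction rule: list_all2_induct) auto
    then show ?case using root_path_nonempty[OF path] by simp
  next
    case 4
    have "\<forall>p\<in>#sum_list Qs. sorted (map \<pi> p)" if "\<forall>t\<in>set F. increasing_tree \<pi> t"
      using \<open>list_all2 _ F Qs\<close> that by (induction rule: list_all2_induct) auto
    then show ?case using root_path_increasing[OF path 4] by auto
  }
qed

lemma labels_hd_lrm_subtree: "hd (labels (lrm_subtree n \<pi> i)) = i"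
  by (subst lrm_subtree.simps) simp

lemma increasing_lrm_subtree:
  assumes "\<pi> permutes {1..n}"
  shows "increasing_tree \<pi> (lrm_subtree n \<pi> i)"
  using assms
proof (induction n \<pi> i rule: lrm_subtree.induct)
  case (1 n \<pi> i)
  then show ?case
    using perm_psv_less[OF "1.prems"]
    by (subst lrm_subtree.simps) (auto simp: labels_hd_lrm_subtree simp del: upt_Suc)
qed

text \<open>Counting leaves along the preorder makes the count for the whole tree run over
  \<open>[0..<n + 1]\<close>, where it can be compared with run ends.\<close>

lemma leaves_lrm_subtree:
  assumes "\<pi> permutes {1..n}"
  shows "leaves (lrm_subtree n \<pi> i) =
    length (filter (\<lambda>j. kids n \<pi> j (n + 1) = []) (labels (lrm_subtree n \<pi> i)))"
  using assms
proof (induction n \<pi> i rule: lrm_subtree.induct)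
  case (1 n \<pi> i)
  let ?js = "filter (\<lambda>j. psv \<pi> j = i) [1..<n + 1]"
  let ?leaf = "\<lambda>j. kids n \<pi> j (n + 1) = []"
  have kids: "kids n \<pi> i (n + 1) = map (lrm_subtree n \<pi>) ?js"
    by (rule kids_def[OF "1.prems"])
  have "(\<Sum>t\<leftarrow>map (lrm_subtree n \<pi>) ?js. leaves t) =
      (\<Sum>j\<leftarrow>?js. length (filter ?leaf (labels (lrm_subtree n \<pi> j))))"
    unfolding map_map comp_def using 1
    by (intro arg_cong[where f = sum_list] map_cong refl) blast
  also have "\<dots> = length (filter ?leaf (concat (map labels (map (lrm_subtree n \<pi>) ?js))))"
    by (simp add: filter_concat length_concat comp_def del: upt_Suc)
  finally have "(\<Sum>t\<leftarrow>kids n \<pi> i (n + 1). leaves t) =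
      length (filter ?leaf (concat (map labels (kids n \<pi> i (n + 1)))))"
    unfolding kids .
  then show ?case
    unfolding lrm_subtree_eq[OF "1.prems", of i] by (cases "?leaf i") simp_all
qed

lemma leaves_lrm_tree:
  assumes "\<pi> permutes {1..n}" "1 \<le> n"
  shows "leaves (lrm_tree n \<pi>) = runs n \<pi>"
proof -
  let ?leaf = "\<lambda>j. kids n \<pi> j (n + 1) = []"
  \<comment> \<open>Position 1 is a child of the root, so the root is not counted. The last run ends
    at \<open>n\<close>, which gives the 1 in \<open>runs\<close>.\<close>
  have "psv \<pi> 1 = 0" using psv_less[of 1 \<pi>] by simp
  then have "\<not> ?leaf 0"
    unfolding kids_def[OF assms(1)] using assms(2) by (auto simp: filter_empty_conv simp del: upt_Suc)
  then have "{j. j < n + 1 \<and> ?leaf j} = insert n {t. 1 \<le> t \<and> t < n \<and> \<pi> (t + 1) < \<pi> t}"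
    using kids_empty_iff[OF assms(1)] assms(2)
    by (auto simp: Suc_le_eq less_Suc_eq_le) (metis gr0I)+
  moreover have "leaves (lrm_tree n \<pi>) = length (filter ?leaf [0..<n + 1])"
    using leaves_lrm_subtree[OF assms(1), of 0] labels_build_lrm_tree[of \<pi> n]
      result_build_lrm_tree[OF assms(1)] by (simp add: lrm_tree_def)
  moreover have "length (filter ?leaf [0..<n + 1]) = card {j. j < n + 1 \<and> ?leaf j}"
    by (subst distinct_card[symmetric]) (auto intro!: arg_cong[where f = card] simp del: upt_Suc)
  ultimately show ?thesis
    by (simp add: runs_def)
qed

subsection \<open>The Huffman construction with leftist heaps\<close>

fun heap_mset :: "heap \<Rightarrow> mtree multiset" where
  "heap_mset Empty = {#}"
| "heap_mset (Heap k t l r) = add_mset t (heap_mset l + heap_mset r)"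

fun leftist :: "heap \<Rightarrow> bool" where
  "leftist Empty = True"
| "leftist (Heap k t l r) \<longleftrightarrow> leftist l \<and> leftist r \<and> rk r \<le> rk l \<and> k = Suc (rk r) \<and>
     (\<forall>c \<in># heap_mset l + heap_mset r. wt t \<le> wt c)"

text \<open>Both subheaps have at least the rank of the right one, so the size plus one at least
  doubles with each rank.\<close>

lemma leftist_rank: "leftist h \<Longrightarrow> 2 ^ rk h \<le> size (heap_mset h) + 1"
proof (induction h)
  case (Heap k t l r)
  have "(2::nat) ^ rk r \<le> 2 ^ rk l" using Heap.prems by simp
  moreover have "2 ^ rk l \<le> size (heap_mset l) + 1" "2 ^ rk r \<le> size (heap_mset r) + 1"
    using Heap by simp_all
  ultimately have "2 * 2 ^ rk r \<le> size (heap_mset l) + size (heap_mset r) + 2" by linarith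
  then show ?case using Heap.prems by simp
qed simp

lemma heap_mset_mk_heap [simp]:
  "heap_mset (mk_heap t l r) = add_mset t (heap_mset l + heap_mset r)"
  by (simp add: mk_heap_def)

lemma leftist_mk_heap:
  "leftist l \<Longrightarrow> leftist r \<Longrightarrow> (\<forall>c \<in># heap_mset l + heap_mset r. wt t \<le> wt c) \<Longrightarrow>
     leftist (mk_heap t l r)"
  by (auto simp: mk_heap_def)

lemma heap_mset_meld [simp]:
  "heap_mset (result \<pi> (meld g h)) = heap_mset g + heap_mset h"
  by (induction g h rule: meld.induct) auto

lemma leftist_meld:
  "leftist g \<Longrightarrow> leftist h \<Longrightarrow> leftist (result \<pi> (meld g h))"
  by (induction g h rule: meld.induct) (auto intro!: leftist_mk_heap, (metis UnCI linear order_trans)+)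

lemma comparisons_meld [simp]: "comparisons \<pi> (meld g h) = 0"
  by (induction g h rule: meld.induct) auto

text \<open>Melding descends the two right spines only, and the rank is the length of the right
  spine.\<close>

lemma internal_ops_meld:
  "leftist g \<Longrightarrow> leftist h \<Longrightarrow> internal_ops \<pi> (meld g h) \<le> rk g + rk h + 1"
  by (induction g h rule: meld.induct) auto

lemma rank_le_log:
  assumes "leftist h" "size (heap_mset h) \<le> N" "N + 1 < 2 ^ Suc L"
  shows "rk h \<le> L"
proof -
  have "(2::nat) ^ rk h < 2 ^ Suc L" using leftist_rank[OF assms(1)] assms(2,3) by linarith
  then show ?thesis by (metis less_Suc_eq_le nat_power_less_imp_less zero_less_numeral)
qed

lemma internal_ops_meld_log:
  assumes "leftist g" "leftist h" "size (heap_mset g) \<le> N" "size (heap_mset h) \<le> N"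
    "N + 1 < 2 ^ Suc L"
  shows "internal_ops \<pi> (meld g h) \<le> 2 * L + 1"
  using internal_ops_meld[OF assms(1,2), of \<pi>] rank_le_log[OF assms(1,3,5)]
    rank_le_log[OF assms(2,4,5)] by linarith

lemma enqueue_correct:
  assumes "leftist h" "parts_ok ps"
  shows "\<exists>h'. result \<pi> (enqueue ps m h) = (m + length ps, h') \<and> leftist h' \<and>
    heap_mset h' = image_mset (\<lambda>p. Leaf (length p) p) (mset (map snd ps)) + heap_mset h"
  using assms
proof (induction ps m h rule: enqueue.induct)
  case (2 w p ps m h)
  let ?h = "result \<pi> (meld (Heap 1 (Leaf w p) Empty Empty) h)"
  have "leftist ?h" using "2.prems" by (intro leftist_meld) auto
  then show ?case using "2.IH"[of ?h] "2.prems" by fastforce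
qed auto

lemma comparisons_enqueue [simp]: "comparisons \<pi> (enqueue ps m h) = 0"
  by (induction ps m h rule: enqueue.induct) auto

lemma internal_ops_enqueue:
  assumes "leftist h" "size (heap_mset h) + length ps \<le> N" "N + 1 < 2 ^ Suc L"
  shows "internal_ops \<pi> (enqueue ps m h) \<le> length ps * (2 * L + 2) + 1"
  using assms
proof (induction ps m h rule: enqueue.induct)
  case (2 w p ps m h)
  let ?h = "result \<pi> (meld (Heap 1 (Leaf w p) Empty Empty) h)"
  have "leftist ?h" using "2.prems" by (intro leftist_meld) auto
  then have "internal_ops \<pi> (enqueue ps (Suc m) ?h) \<le> length ps * (2 * L + 2) + 1"
    using "2.prems" by (intro "2.IH") auto
  moreover have "internal_ops \<pi> (meld (Heap 1 (Leaf w p) Empty Empty) h) \<le> 2 * L + 1"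
    using "2.prems" by (intro internal_ops_meld_log[of _ _ N]) auto
  ultimately show ?case by simp
qed simp

lemma delete_least:
  assumes "leftist h" "heap_mset h \<noteq> {#}"
  shows "heap_mset h = add_mset (least h) (heap_mset (left h) + heap_mset (right h))"
    "\<forall>c \<in># heap_mset (left h) + heap_mset (right h). wt (least h) \<le> wt c"
    "leftist (left h)" "leftist (right h)"
  using assms by (cases h; auto)+

text \<open>Deleting the minimum twice yields a pair that a Huffman step may join: the least tree of
  \<open>h\<close> bounds all of \<open>h1\<close>, hence \<open>h2\<close>, and the least of
  \<open>h1\<close> bounds \<open>h2\<close>.\<close>

lemma combine_step:
  fixes \<pi> :: "nat \<Rightarrow> nat"
  assumes "leftist h" "size (heap_mset h) = Suc (Suc m)"
  defines "h1 \<equiv> result \<pi> (meld (left h) (right h))"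
  defines "h2 \<equiv> result \<pi> (meld (left h1) (right h1))"
  defines "h3 \<equiv> result \<pi>
    (meld (Heap 1 (Join (wt (least h) + wt (least h1)) (least h) (least h1)) Empty Empty) h2)"
  shows "leftist h1" "leftist h2" "leftist h3"
    "size (heap_mset h1) = Suc m" "size (heap_mset h2) = m" "size (heap_mset h3) = Suc m"
    "huffman_step (heap_mset h) (heap_mset h3)"
proof -
  have "heap_mset h \<noteq> {#}" using assms(2) by auto
  note h = delete_least[OF assms(1) this]
  show h1: "leftist h1" unfolding h1_def using h by (intro leftist_meld)
  have h_eq: "heap_mset h = add_mset (least h) (heap_mset h1)" using h(1) by (simp add: h1_def)
  then show s1: "size (heap_mset h1) = Suc m" using assms(2) by simp
  then have "heap_mset h1 \<noteq> {#}" by auto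
  note h1' = delete_least[OF h1 this]
  show "leftist h2" unfolding h2_def using h1' by (intro leftist_meld)
  then show "leftist h3" unfolding h3_def by (intro leftist_meld) auto
  have h1_eq: "heap_mset h1 = add_mset (least h1) (heap_mset h2)" using h1'(1) by (simp add: h2_def)
  then show "size (heap_mset h2) = m" using s1 by simp
  then show "size (heap_mset h3) = Suc m" by (simp add: h3_def)
  have "\<forall>c \<in># heap_mset h2. wt (least h) \<le> wt c \<and> wt (least h1) \<le> wt c"
    using h(2) h1'(2) h1_eq
    by (simp add: h1_def[symmetric] h2_def)
       (metis UnCI h1_def heap_mset_meld insertCI set_mset_add_mset_insert set_mset_union union_iff)
  from huffman_step.intros[OF this]
  show "huffman_step (heap_mset h) (heap_mset h3)"
    by (simp add: h_eq h1_eq h3_def add_mset_commute)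
qed

lemma combine_huffman:
  assumes "leftist h" "size (heap_mset h) = Suc m"
  shows "huffman_step\<^sup>*\<^sup>* (heap_mset h) {#result \<pi> (combine m h)#}"
  using assms
proof (induction m h rule: combine.induct)
  case (1 h)
  then have "heap_mset h \<noteq> {#}" by auto
  from delete_least(1)[OF "1.prems"(1) this] "1.prems"(2) show ?case by simp
next
  case (2 m h)
  note step = combine_step[OF "2.prems", of \<pi>]
  from converse_rtranclp_into_rtranclp[OF step(7) "2.IH"[OF refl refl step(3,6)]] show ?case
    by (simp add: Let_def)
qed

lemma comparisons_combine [simp]: "comparisons \<pi> (combine m h) = 0"
  by (induction m h rule: combine.induct) (auto simp: Let_def)

text \<open>Each round takes three melds at \<open>2 * L + 1\<close> and one
  \<open>Step\<close>.\<close>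

lemma internal_ops_combine:
  assumes "leftist h" "size (heap_mset h) = Suc m" "m < N" "N + 1 < 2 ^ Suc L"
  shows "internal_ops \<pi> (combine m h) \<le> m * (6 * L + 4) + 1"
  using assms
proof (induction m h rule: combine.induct)
  case (2 m h)
  note step = combine_step[OF "2.prems"(1,2), of \<pi>]
  let ?h1 = "result \<pi> (meld (left h) (right h))"
  let ?h2 = "result \<pi> (meld (left ?h1) (right ?h1))"
  let ?s = "Heap 1 (Join (wt (least h) + wt (least ?h1)) (least h) (least ?h1)) Empty Empty"
  have h: "heap_mset h \<noteq> {#}" "heap_mset ?h1 \<noteq> {#}" using "2.prems"(2) step(4) by auto
  note d = delete_least[OF "2.prems"(1) h(1)] delete_least[OF step(1) h(2)]
  have s: "size (heap_mset (left h)) + size (heap_mset (right h)) = Suc m"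
      "size (heap_mset (left ?h1)) + size (heap_mset (right ?h1)) = m"
    using step(4,5) by simp_all
  have "internal_ops \<pi> (meld (left h) (right h)) \<le> 2 * L + 1"
    using d s "2.prems" by (intro internal_ops_meld_log[of _ _ N]) auto
  moreover have "internal_ops \<pi> (meld (left ?h1) (right ?h1)) \<le> 2 * L + 1"
    using d s "2.prems" by (intro internal_ops_meld_log[of _ _ N]) auto
  moreover have "internal_ops \<pi> (meld ?s ?h2) \<le> 2 * L + 1"
    using step "2.prems" by (intro internal_ops_meld_log[of _ _ N]) auto
  moreover have "internal_ops \<pi> (combine m (result \<pi> (meld ?s ?h2))) \<le> m * (6 * L + 4) + 1"
    using step "2.prems" by (intro "2.IH"[OF refl refl]) auto
  ultimately show ?case by (simp add: Let_def)
qed simp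

lemma huffman_tree_build:
  assumes "parts_ok ps" "ps \<noteq> []"
  shows "huffman_tree (mset (map snd ps)) (result \<pi> (build_huffman_tree ps))"
proof -
  obtain h where h: "result \<pi> (enqueue ps 0 Empty) = (length ps, h)" "leftist h"
      "heap_mset h = image_mset (\<lambda>p. Leaf (length p) p) (mset (map snd ps))"
    using enqueue_correct[of Empty ps \<pi> 0] assms(1) by auto
  have "size (heap_mset h) = Suc (length ps - 1)" using h(3) assms(2) by simp
  then show ?thesis
    using combine_huffman[OF h(2), of "length ps - 1" \<pi>] h
    by (simp add: huffman_tree_def build_huffman_tree_def)
qed

lemma comparisons_build_huffman_tree [simp]: "comparisons \<pi> (build_huffman_tree ps) = 0"
  by (auto simp: build_huffman_tree_def split: prod.splits)

lemma internal_ops_build_huffman_tree: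
  assumes "parts_ok ps" "ps \<noteq> []"
  shows "real (internal_ops \<pi> (build_huffman_tree ps)) \<le>
    14 * real (length ps) + 8 * real (length ps) * log 2 (real (length ps)) + 2"
proof -
  let ?N = "length ps"
  \<comment> \<open>The integer logarithm, for which \<open>?N + 1 < 2 ^ Suc L\<close>; all heaps
    that occur then have rank at most \<open>L\<close>.\<close>
  define L where "L = nat \<lfloor>log 2 (real (?N + 1))\<rfloor>"
  have N: "1 \<le> ?N" using assms(2) by (simp add: Suc_leI)
  have "log 2 (real (?N + 1)) < real (Suc L)" unfolding L_def by linarith
  then have "real (?N + 1) < 2 powr real (Suc L)" by (subst (asm) log_less_iff) auto
  then have "real (?N + 1) < real (2 ^ Suc L)"
    by (simp only: powr_realpow of_nat_power of_nat_numeral zero_less_numeral)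
  then have L: "?N + 1 < 2 ^ Suc L" by (simp only: of_nat_less_iff)
  obtain h where h: "result \<pi> (enqueue ps 0 Empty) = (?N, h)" "leftist h"
      "heap_mset h = image_mset (\<lambda>p. Leaf (length p) p) (mset (map snd ps))"
    using enqueue_correct[of Empty ps \<pi> 0] assms(1) by auto
  have "internal_ops \<pi> (enqueue ps 0 Empty) \<le> ?N * (2 * L + 2) + 1"
    using L by (intro internal_ops_enqueue) auto
  moreover have "internal_ops \<pi> (combine (?N - 1) h) \<le> (?N - 1) * (6 * L + 4) + 1"
    using L h N by (intro internal_ops_combine) auto
  moreover have "(?N - 1) * (6 * L + 4) \<le> ?N * (6 * L + 4)" by simp
  ultimately have "internal_ops \<pi> (build_huffman_tree ps) \<le> ?N * (8 * L + 6) + 2"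
    using h(1) by (simp add: build_huffman_tree_def algebra_simps)
  then have "real (internal_ops \<pi> (build_huffman_tree ps)) \<le> real ?N * (8 * real L + 6) + 2"
    by (simp flip: of_nat_le_iff[where 'a = real])
  moreover have "real L \<le> 1 + log 2 (real ?N)"
  proof -
    have "0 \<le> log 2 (real (?N + 1))" by simp
    then have "real L \<le> log 2 (real (?N + 1))" unfolding L_def by linarith
    also have "\<dots> \<le> log 2 (2 * real ?N)" using N by (subst log_le_cancel_iff) auto
    also have "\<dots> = 1 + log 2 (real ?N)" using N by (subst log_mult) auto
    finally show ?thesis .
  qed
  then have "real ?N * (8 * real L + 6) \<le> real ?N * (8 * (1 + log 2 (real ?N)) + 6)"
    by (intro mult_left_mono) auto
  ultimately show ?thesis by (simp add: algebra_simps)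
qed

subsection \<open>Merging along the tree\<close>

lemma internal_ops_merge [simp]: "internal_ops \<pi> (merge xs ys) = 1"
  by (induction xs ys rule: merge.induct) auto

lemma comparisons_merge: "comparisons \<pi> (merge xs ys) \<le> length xs + length ys"
  by (induction xs ys rule: merge.induct) auto

lemma mset_merge [simp]: "mset (result \<pi> (merge xs ys)) = mset xs + mset ys"
  by (induction xs ys rule: merge.induct) auto

lemma set_merge [simp]: "set (result \<pi> (merge xs ys)) = set xs \<union> set ys"
  by (metis mset_merge set_mset_mset set_mset_union)

lemma sorted_merge:
  "sorted (map \<pi> xs) \<Longrightarrow> sorted (map \<pi> ys) \<Longrightarrow> sorted (map \<pi> (result \<pi> (merge xs ys)))"
  by (induction xs ys rule: merge.induct) (auto dest: order_trans)

fun sequences :: "mtree \<Rightarrow> nat list multiset" where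
  "sequences (Leaf w p) = {#p#}"
| "sequences (Join w a b) = sequences a + sequences b"

fun weights_ok :: "mtree \<Rightarrow> bool" where
  "weights_ok (Leaf w p) \<longleftrightarrow> w = length p"
| "weights_ok (Join w a b) \<longleftrightarrow> w = wt a + wt b \<and> weights_ok a \<and> weights_ok b"

lemma huffman_steps_invariant:
  "huffman_step\<^sup>*\<^sup>* F G \<Longrightarrow> (\<Sum>t\<in>#G. sequences t) = (\<Sum>t\<in>#F. sequences t) \<and>
     ((\<forall>t\<in>#F. weights_ok t) \<longrightarrow> (\<forall>t\<in>#G. weights_ok t))"
  by (induction rule: rtranclp_induct) (auto elim!: huffman_step.cases simp: ac_simps)

lemma huffman_tree_sequences:
  assumes "huffman_tree P t"
  shows "sequences t = P" "weights_ok t"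
proof -
  have "(\<Sum>t\<in>#image_mset (\<lambda>p. Leaf (length p) p) P. sequences t) = P"
    by (induction P) auto
  then show "sequences t = P" "weights_ok t"
    using huffman_steps_invariant[OF assms[unfolded huffman_tree_def]] by auto
qed

lemma mset_merge_along:
  "mset (result \<pi> (merge_along t)) = (\<Sum>p\<in>#sequences t. mset p)"
  by (induction t) auto

lemma sorted_merge_along:
  "\<forall>p\<in>#sequences t. sorted (map \<pi> p) \<Longrightarrow> sorted (map \<pi> (result \<pi> (merge_along t)))"
  by (induction t) (auto intro: sorted_merge)

lemma length_merge_along: "weights_ok t \<Longrightarrow> length (result \<pi> (merge_along t)) = wt t"
proof (induction t)
  case (Join w a b)
  then show ?case
    by (metis result_bind result.simps(2) merge_along.simps(2) mset_merge mtree.sel(2) size_mset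
        size_union weights_ok.simps(2))
qed auto

text \<open>One operation per leaf and two per join, the second in the final call of
  \<open>merge\<close>; there is one join fewer than leaves.\<close>

lemma internal_ops_merge_along:
  "internal_ops \<pi> (merge_along t) + 2 = 3 * size (sequences t)"
  by (induction t) auto

subsection \<open>Optimality of Huffman merging\<close>

text \<open>With correct weights this is the weighted path length, since each leaf is counted once
  per proper ancestor.\<close>

fun join_cost :: "mtree \<Rightarrow> nat" where
  "join_cost (Leaf w p) = 0"
| "join_cost (Join w a b) = w + join_cost a + join_cost b"

text \<open>The Kraft sum of a multiset of binary codeword lengths.\<close>

definition kraft :: "nat multiset \<Rightarrow> real" where
  "kraft ls = (\<Sum>l\<in>#ls. (1 / 2) ^ l)"

text \<open>The pairs assign a prospective depth to each tree of a forest, without a larger tree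
  that realises these depths.\<close>

definition depth_cost :: "(mtree \<times> nat) multiset \<Rightarrow> nat" where
  "depth_cost M = (\<Sum>(t, l)\<in>#M. wt t * l)"

lemma kraft_simps [simp]:
  "kraft {#} = 0" "kraft (add_mset l ls) = (1 / 2) ^ l + kraft ls"
  by (simp_all add: kraft_def)

lemma kraft_nonneg: "0 \<le> kraft ls"
  by (induction ls) auto

lemma depth_cost_simps [simp]:
  "depth_cost {#} = 0" "depth_cost (add_mset (t, l) M) = wt t * l + depth_cost M"
  by (simp_all add: depth_cost_def)

lemma kraft_scaled_nat:
  "(\<And>l. l \<in># ls \<Longrightarrow> l \<le> d) \<Longrightarrow> \<exists>k::nat. kraft ls * 2 ^ d = real k"
proof (induction ls)
  case (add l ls)
  then obtain k where "kraft ls * 2 ^ d = real k" by auto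
  moreover have "(1 / 2 :: real) ^ l * 2 ^ d = 2 ^ (d - l)"
    using add.prems[of l] by (simp add: power_diff power_one_over field_simps)
  ultimately have "kraft (add_mset l ls) * 2 ^ d = real (2 ^ (d - l) + k)"
    by (simp add: algebra_simps)
  then show ?case by blast
qed auto

text \<open>A Kraft sum below 1 over lengths at most \<open>d\<close> is a multiple of \<open>2\<^sup>-\<^sup>d\<close>, which leaves room for
  another word of length \<open>d\<close>.\<close>

lemma kraft_room:
  assumes "\<And>l. l \<in># ls \<Longrightarrow> l \<le> d" "kraft ls < 1"
  shows "(1 / 2) ^ d + kraft ls \<le> 1"
proof -
  obtain k where k: "kraft ls * 2 ^ d = real k"
    using kraft_scaled_nat[of ls d] assms(1) by blast
  have "real k < real (2 ^ d)"
    using assms(2) k by (metis less_numeral_extra(1) mult_strict_right_mono mult_1 of_nat_numeral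
        of_nat_power zero_less_numeral zero_less_power)
  then have "k + 1 \<le> 2 ^ d" by (simp only: of_nat_less_iff)
  then have "real (k + 1) \<le> real (2 ^ d)" by (simp only: of_nat_le_iff)
  then have "((1 / 2) ^ d + kraft ls) * 2 ^ d \<le> 1 * 2 ^ d"
    using k by (simp add: algebra_simps power_one_over)
  then show ?thesis
    by (rule mult_right_le_imp_le) simp
qed

text \<open>Swapping the length of a lightest tree with the largest length cannot raise the cost.
  The lengths are only permuted, so the Kraft sum is unchanged.\<close>

lemma exchange_deepest:
  assumes "\<And>c. c \<in># image_mset fst M \<Longrightarrow> wt a \<le> wt c"
  shows "\<exists>M' la'. image_mset fst M' = image_mset fst M \<and>
    add_mset la' (image_mset snd M') = add_mset la (image_mset snd M) \<and>
    wt a * la' + depth_cost M' \<le> wt a * la + depth_cost M \<and>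
    (\<forall>l \<in># image_mset snd M'. l \<le> la')"
proof (cases "\<forall>l \<in># image_mset snd M. l \<le> la")
  case False
  define l where "l = Max (set_mset (image_mset snd M))"
  have ne: "set_mset (image_mset snd M) \<noteq> {}" using False by auto
  then have "l \<in># image_mset snd M" unfolding l_def by (intro Max_in) auto
  then obtain c where c: "(c, l) \<in># M" by auto
  then obtain N where N: "M = add_mset (c, l) N" by (metis multi_member_split)
  have max: "k \<le> l" if "k \<in># image_mset snd M" for k
    unfolding l_def using that by (intro Max_ge) auto
  have la: "la \<le> l" using False max by (meson le_trans linear)
  have "wt a \<le> wt c" using assms N by auto
  then have "wt a * l + wt c * la \<le> wt a * la + wt c * l"
  proof -
    obtain x where "wt c = wt a + x" using \<open>wt a \<le> wt c\<close> le_Suc_ex by blast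
    then show ?thesis using la by (simp add: algebra_simps)
  qed
  then show ?thesis
    using N max la by (intro exI[of _ "add_mset (c, la) N"] exI[of _ l]) auto
qed auto

text \<open>Two exchanges move the lightest trees \<open>a\<close> and \<open>b\<close> to the
  greatest lengths. Then \<open>a\<close> is shortened to the length of \<open>b\<close>, and the
  two equal lengths are replaced by that of a common parent, one less, which is the \<open>d\<close>
  of the statement.\<close>

lemma kraft_siblings_ordered:
  assumes "wt a \<le> wt b" "\<And>c. c \<in># F \<Longrightarrow> wt b \<le> wt c"
    and "image_mset fst M = add_mset a (add_mset b F)" "kraft (image_mset snd M) \<le> 1"
  shows "\<exists>N d. image_mset fst N = F \<and> kraft (image_mset snd N) + (1 / 2) ^ d \<le> 1 \<and>
    depth_cost N + (wt a + wt b) * Suc d \<le> depth_cost M"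
proof -
  obtain M1 la where M1: "M = add_mset (a, la) M1" "image_mset fst M1 = add_mset b F"
    using msed_map_invR[OF assms(3)] by fastforce
  obtain M2 la' where M2: "image_mset fst M2 = add_mset b F"
      "add_mset la' (image_mset snd M2) = image_mset snd M"
      "wt a * la' + depth_cost M2 \<le> depth_cost M" "\<forall>l \<in># image_mset snd M2. l \<le> la'"
    using exchange_deepest[of M1 a la] M1 assms(1,2) by (auto dest: order_trans)
  obtain M3 lb where M3: "M2 = add_mset (b, lb) M3" "image_mset fst M3 = F"
    using msed_map_invR[OF M2(1)] by fastforce
  obtain N d where N: "image_mset fst N = F"
      "add_mset d (image_mset snd N) = image_mset snd M2"
      "wt b * d + depth_cost N \<le> depth_cost M2" "\<forall>l \<in># image_mset snd N. l \<le> d"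
    using exchange_deepest[of M3 b lb] M3 assms(2) by auto
  have d: "d \<le> la'" using M2(4) N(2) by (metis union_single_eq_member)
  have kraft: "(1 / 2) ^ la' + kraft (image_mset snd M2) \<le> 1"
    using assms(4) unfolding M2(2)[symmetric] by simp
  \<comment> \<open>Without \<open>a\<close> the sum is strictly below 1 and all lengths are at most
    \<open>d\<close>, so by \<open>kraft_room\<close> a word of length \<open>d\<close> fits in
    place of the one of length \<open>la'\<close>.\<close>
  then have "kraft (image_mset snd M2) < 1"
    by (smt (verit) zero_less_divide_1_iff zero_less_power)
  moreover have "l \<le> d" if "l \<in># image_mset snd M2" for l
    using that N(4) unfolding N(2)[symmetric] by auto
  ultimately have "(1 / 2) ^ d + kraft (image_mset snd M2) \<le> 1"
    by (intro kraft_room) auto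
  then have two: "(1 / 2) ^ d + ((1 / 2) ^ d + kraft (image_mset snd N)) \<le> 1"
    unfolding N(2)[symmetric] by simp
  \<comment> \<open>Two words of length 0 already have Kraft sum 2.\<close>
  have "d \<noteq> 0"
    using two kraft_nonneg[of "image_mset snd N"] by (intro notI) simp
  then obtain e where e: "d = Suc e" by (cases d) auto
  have "depth_cost N + (wt a + wt b) * d \<le> depth_cost M"
    using N(3) M2(3) mult_le_mono2[OF d, of "wt a"] unfolding distrib_right by linarith
  then show ?thesis
    using two N(1) e by (intro exI[of _ N] exI[of _ e]) auto
qed

lemma kraft_siblings:
  assumes "\<And>c. c \<in># F \<Longrightarrow> wt a \<le> wt c \<and> wt b \<le> wt c"
    and "image_mset fst M = add_mset a (add_mset b F)" "kraft (image_mset snd M) \<le> 1"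
  shows "\<exists>N d. image_mset fst N = F \<and> kraft (image_mset snd N) + (1 / 2) ^ d \<le> 1 \<and>
    depth_cost N + (wt a + wt b) * Suc d \<le> depth_cost M"
proof (cases "wt a \<le> wt b")
  case True
  then show ?thesis using assms by (intro kraft_siblings_ordered) auto
next
  case False
  then have "\<exists>N d. image_mset fst N = F \<and> kraft (image_mset snd N) + (1 / 2) ^ d \<le> 1 \<and>
      depth_cost N + (wt b + wt a) * Suc d \<le> depth_cost M"
    using assms by (intro kraft_siblings_ordered) (auto simp: add_mset_commute)
  then show ?thesis by (simp add: add.commute)
qed

text \<open>The induction removes the first step, so the lengths are transformed along with the
  forest: those for the forest after the join save at least the weight of the join, which is what
  \<open>join_cost\<close> gains.\<close>

lemma join_cost_huffman_le:
  assumes "huffman_step\<^sup>*\<^sup>* F {#t#}" "image_mset fst M = F" "kraft (image_mset snd M) \<le> 1"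
  shows "join_cost t \<le> (\<Sum>c\<in>#F. join_cost c) + depth_cost M"
  using assms
proof (induction arbitrary: M rule: converse_rtranclp_induct)
  case (step F G)
  from step.hyps(1) obtain F0 a b where F: "F = F0 + {#a, b#}"
      "G = F0 + {#Join (wt a + wt b) a b#}" "\<forall>c\<in>#F0. wt a \<le> wt c \<and> wt b \<le> wt c"
    by (cases rule: huffman_step.cases) auto
  have "image_mset fst M = add_mset a (add_mset b F0)" using step.prems F by simp
  then obtain N d where N: "image_mset fst N = F0"
      "kraft (image_mset snd N) + (1 / 2) ^ d \<le> 1"
      "depth_cost N + (wt a + wt b) * Suc d \<le> depth_cost M"
    using kraft_siblings[of F0 a b M] F(3) step.prems by auto
  have "join_cost t \<le> (\<Sum>c\<in>#G. join_cost c) +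
      depth_cost (add_mset (Join (wt a + wt b) a b, d) N)"
    using N F by (intro step.IH) auto
  then show ?case using N(3) F by simp
qed simp

text \<open>Rounding up makes each summand at most \<open>k / n\<close>. Keeping \<open>n\<close>
  independent of \<open>ks\<close> lets the induction remove elements.\<close>

lemma kraft_ceiling:
  "n > 0 \<Longrightarrow> (\<And>k. k \<in># ks \<Longrightarrow> 0 < k) \<Longrightarrow>
    kraft (image_mset (\<lambda>k. nat \<lceil>log 2 (real n / real k)\<rceil>) ks) \<le> real (sum_mset ks) / real n"
proof (induction ks)
  case (add k ks)
  have k: "0 < k" using add.prems by auto
  let ?x = "real n / real k"
  have "log 2 ?x \<le> real (nat \<lceil>log 2 ?x\<rceil>)" by linarith
  then have "?x \<le> 2 powr real (nat \<lceil>log 2 ?x\<rceil>)"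
    using k add.prems(1) by (subst (asm) log_le_iff) auto
  then have "?x \<le> 2 ^ nat \<lceil>log 2 ?x\<rceil>" by (simp add: powr_realpow)
  then have "(1 / 2) ^ nat \<lceil>log 2 ?x\<rceil> \<le> 1 / ?x"
    using k add.prems(1) unfolding power_one_over by (intro divide_left_mono) auto
  moreover have "kraft (image_mset (\<lambda>k. nat \<lceil>log 2 (real n / real k)\<rceil>) ks)
      \<le> real (sum_mset ks) / real n"
    using add by auto
  ultimately show ?case by (simp add: add_divide_distrib)
qed simp

lemma sum_list_mult_entropy:
  assumes "sum_list ns = n" "0 < n"
  shows "(\<Sum>k\<leftarrow>ns. real k + real k * log 2 (real n / real k)) = real n * (1 + entropy ns)"
proof -
  have "real n * entropy ns = (\<Sum>k\<leftarrow>ns. real n * (real k / real n * log 2 (real n / real k)))"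
    unfolding entropy_def assms(1) Let_def by (rule sum_list_const_mult[symmetric])
  also have "\<dots> = (\<Sum>k\<leftarrow>ns. real k * log 2 (real n / real k))"
    using assms(2) by simp
  finally show ?thesis
    using assms(1) by (simp add: sum_list_addf distrib_left sum_list_of_nat)
qed

lemma join_cost_huffman_tree_le_entropy:
  assumes "huffman_tree (mset ps) t" "ps \<noteq> []" "[] \<notin> set ps"
  shows "real (join_cost t) \<le>
    real (sum_list (map length ps)) * (1 + entropy (map length ps))"
proof -
  define n where "n = sum_list (map length ps)"
  \<comment> \<open>Shannon code lengths: rounding adds at most 1 to each logarithm, the source of
    the \<open>1 +\<close> in the bound.\<close>
  define f where "f = (\<lambda>k. nat \<lceil>log 2 (real n / real k)\<rceil>)"
  define M where "M = image_mset (\<lambda>p. (Leaf (length p) p, f (length p))) (mset ps)"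
  have pos: "0 < length p" if "p \<in> set ps" for p using that assms(3) by auto
  have le_n: "length p \<le> n" if "p \<in> set ps" for p
    unfolding n_def using that by (intro member_le_sum_list) auto
  have n: "0 < n"
    using pos[of "hd ps"] le_n[of "hd ps"] assms(2) by (meson hd_in_set less_le_trans)
  have "kraft (image_mset f (mset (map length ps))) \<le> real (sum_mset (mset (map length ps))) / real n"
    unfolding f_def using n pos by (intro kraft_ceiling) auto
  also have "\<dots> = 1" using n unfolding sum_mset_sum_list n_def[symmetric] by simp
  finally have "kraft (image_mset snd M) \<le> 1"
    by (simp add: M_def image_mset.compositionality comp_def)
  then have "join_cost t \<le>
      (\<Sum>c\<in>#image_mset (\<lambda>p. Leaf (length p) p) (mset ps). join_cost c) + depth_cost M"
    using assms(1) unfolding huffman_tree_def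
    by (intro join_cost_huffman_le) (auto simp: M_def image_mset.compositionality comp_def)
  also have "\<dots> = depth_cost M"
    by (simp add: image_mset.compositionality comp_def)
  also have "\<dots> = (\<Sum>p\<leftarrow>ps. length p * f (length p))"
    unfolding depth_cost_def M_def
    by (simp add: image_mset.compositionality comp_def sum_mset_sum_list flip: mset_map)
  finally have "real (join_cost t) \<le> real (\<Sum>p\<leftarrow>ps. length p * f (length p))"
    by (rule of_nat_mono)
  also have "\<dots> = (\<Sum>p\<leftarrow>ps. real (length p) * real (f (length p)))"
    by (induction ps) auto
  also have "\<dots> \<le> (\<Sum>p\<leftarrow>ps. real (length p) + real (length p) * log 2 (real n / real (length p)))"
  proof (rule sum_list_mono)
    fix p assume p: "p \<in> set ps"
    have "0 \<le> log 2 (real n / real (length p))"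
      using pos[OF p] le_n[OF p] n by (subst zero_le_log_cancel_iff) auto
    then have "real (f (length p)) \<le> 1 + log 2 (real n / real (length p))"
      unfolding f_def by linarith
    from mult_left_mono[OF this, of "real (length p)"]
    show "real (length p) * real (f (length p))
      \<le> real (length p) + real (length p) * log 2 (real n / real (length p))"
      by (simp add: algebra_simps)
  qed
  also have "\<dots> = real n * (1 + entropy (map length ps))"
    using sum_list_mult_entropy[OF n_def[symmetric] n] by (simp add: comp_def)
  finally show ?thesis by (simp add: n_def)
qed

section \<open>Lower bounds on the entropy\<close>

lemma entropy_nonneg:
  assumes "\<And>k. k \<in> set ns \<Longrightarrow> 0 < k"
  shows "0 \<le> entropy ns"
proof -
  define n where "n = sum_list ns"
  have "0 \<le> real k / real n * log 2 (real n / real k)" if k: "k \<in> set ns" for k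
  proof -
    have "0 < k" "k \<le> n"
      using assms[OF k] k unfolding n_def by (auto intro: member_le_sum_list)
    then show ?thesis
      by (intro mult_nonneg_nonneg) (auto simp: zero_le_log_cancel_iff)
  qed
  then show ?thesis
    unfolding entropy_def Let_def n_def[symmetric] by (intro sum_list_nonneg) auto
qed

text \<open>With the number of parts enlarged to \<open>n\<close> inside the logarithm, each part
  pays for its own \<open>log 2 n\<close>, split into \<open>log 2 (n / k)\<close> and
  \<open>log 2 k\<close>.\<close>

lemma length_log_le_entropy:
  assumes "\<And>k. k \<in> set ns \<Longrightarrow> 0 < k" "ns \<noteq> []"
  shows "real (length ns) * log 2 (real (length ns)) \<le> real (sum_list ns) * (1 + entropy ns)"
proof -
  define n where "n = sum_list ns"
  have n: "0 < n" using assms by (cases ns) (auto simp: n_def)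
  have "length ns \<le> n"
    unfolding n_def using assms(1) by (induction ns) force+
  then have "real (length ns) * log 2 (real (length ns)) \<le> real (length ns) * log 2 (real n)"
    using assms(2) n by (intro mult_left_mono) auto
  also have "\<dots> = (\<Sum>k\<leftarrow>ns. log 2 (real n))"
    by (simp add: sum_list_triv)
  also have "\<dots> \<le> (\<Sum>k\<leftarrow>ns. real k + real k * log 2 (real n / real k))"
  proof (rule sum_list_mono)
    fix k assume k: "k \<in> set ns"
    have "0 < k" using assms(1) k .
    have "k \<le> n" unfolding n_def using k by (intro member_le_sum_list) auto
    have "0 \<le> log 2 (real n / real k)"
      using \<open>0 < k\<close> \<open>k \<le> n\<close> by (subst zero_le_log_cancel_iff) auto
    then have "1 * log 2 (real n / real k) \<le> real k * log 2 (real n / real k)"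
      using \<open>0 < k\<close> by (intro mult_right_mono) auto
    moreover have "log 2 (real k) \<le> real k"
      using log2_of_power_le[of k k] \<open>0 < k\<close> less_exp[of k] by (simp add: less_imp_le)
    moreover have "log 2 (real n / real k) = log 2 (real n) - log 2 (real k)"
      using \<open>0 < k\<close> n by (simp add: log_divide)
    ultimately show "log 2 (real n) \<le> real k + real k * log 2 (real n / real k)" by linarith
  qed
  also have "\<dots> = real n * (1 + entropy ns)"
    by (rule sum_list_mult_entropy[OF n_def[symmetric] n])
  finally show ?thesis by (simp add: n_def)
qed

subsection \<open>The sorting algorithm\<close>

lemma comparisons_merge_along:
  "weights_ok t \<Longrightarrow> comparisons \<pi> (merge_along t) \<le> join_cost t"
proof (induction t)
  case (Join w a b)
  then show ?case
    using comparisons_merge[of \<pi> "result \<pi> (merge_along a)" "result \<pi> (merge_along b)"]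
    by (simp add: length_merge_along)
qed simp

lemma lrm_partition_properties:
  assumes "\<pi> permutes {1..n}" "1 \<le> n" "lrm_partition n \<pi> P"
  shows "size P = runs n \<pi>" "[] \<notin># P" "(\<Sum>p\<in>#P. mset p) = mset [1..<n + 1]"
    "\<forall>p\<in>#P. sorted (map \<pi> p)"
proof -
  let ?T = "lrm_tree n \<pi>"
  obtain p F Qs where pF: "longest_root_path ?T p F" "list_all2 tree_partition F Qs"
      "P = add_mset (tl p) (sum_list Qs)"
    using assms(3) by (auto simp: lrm_partition_def)
  \<comment> \<open>Keeping the root in its part gives an ordinary \<open>tree_partition\<close>
    with the general properties; the root is removed afterwards.\<close>
  have part: "tree_partition ?T (add_mset p (sum_list Qs))"
    using pF(1,2) by (rule tree_partition.intros)
  have path: "root_path ?T p F" using pF(1) by (simp add: longest_root_path_def)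
  have labels: "labels ?T = 0 # [1..<n + 1]"
    using labels_build_lrm_tree[of \<pi> n] result_build_lrm_tree[OF assms(1)]
    by (simp add: upt_conv_Cons)
  have inc: "increasing_tree \<pi> ?T"
    unfolding lrm_tree_def by (rule increasing_lrm_subtree[OF assms(1)])
  note part' = tree_partition_properties(1-3)[OF part] tree_partition_properties(4)[OF part inc]
  show "size P = runs n \<pi>"
    using part'(2) leaves_lrm_tree[OF assms(1,2)] pF(3) by simp
  have hd: "p = 0 # tl p"
    using root_path_increasing[OF path inc] root_path_nonempty[OF path] labels
    by (cases p) auto
  show "\<forall>p\<in>#P. sorted (map \<pi> p)"
    using part'(4) pF(3) by (auto simp: map_tl sorted_tl)
  have "add_mset 0 (\<Sum>p\<in>#P. mset p) = add_mset 0 (mset [1..<n + 1])"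
    using part'(1) labels hd pF(3)
    by (metis (no_types, lifting) image_mset_add_mset mset.simps(2) sum_mset.add_mset
        union_mset_add_mset_left)
  then show "(\<Sum>p\<in>#P. mset p) = mset [1..<n + 1]" by (simp only: add_mset_add_mset_same_iff)
  \<comment> \<open>Otherwise the root would be a leaf, yet the tree has
    \<open>n + 1 \<ge> 2\<close> nodes.\<close>
  have "tl p \<noteq> []"
  proof
    assume "tl p = []"
    then have "root_path ?T [0] F" using path hd by simp
    then show False
    proof (cases rule: root_path.cases)
      case leaf
      then show ?thesis using labels assms(2) by simp
    qed (auto dest: root_path_nonempty)
  qed
  then show "[] \<notin># P" using part'(3) pF(3) by auto
qed

lemma sum_mset_length: "(\<Sum>p\<in>#P. mset p) = mset xs \<Longrightarrow> (\<Sum>p\<in>#P. length p) = length xs"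
proof -
  have "size (\<Sum>p\<in>#P. mset p) = (\<Sum>p\<in>#P. length p)" by (induction P) auto
  then show "(\<Sum>p\<in>#P. mset p) = mset xs \<Longrightarrow> (\<Sum>p\<in>#P. length p) = length xs" by simp
qed

lemma lrm_sort_spec:
  fixes n :: nat and \<pi> :: "nat \<Rightarrow> nat"
  assumes n: "1 \<le> n" and perm: "\<pi> permutes {1..n}"
  defines "T \<equiv> result \<pi> (build_lrm_tree n)"
  defines "ps \<equiv> result \<pi> (extract_partition T)"
  defines "M \<equiv> result \<pi> (build_huffman_tree ps)"
  defines "ns \<equiv> map length (map snd ps)" and "\<rho> \<equiv> runs n \<pi>" and "out \<equiv> result \<pi> (lrm_sort n)"
  shows "T = lrm_tree n \<pi>" "lrm_partition n \<pi> (mset (map snd ps))" "length ns = \<rho>"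
    "sum_list ns = n" "huffman_tree (mset (map snd ps)) M" "out = result \<pi> (merge_along M)"
    "mset (map \<pi> out) = mset (map \<pi> [1..<n + 1])" "sorted (map \<pi> out)"
    "real (comparisons \<pi> (lrm_sort n)) \<le> real n * (3 + entropy ns)"
    "real (internal_ops \<pi> (lrm_sort n)) \<le> 32 * (real n + real \<rho> * log 2 (real \<rho>))"
    "real (total_time \<pi> (lrm_sort n)) \<le> 67 * (real n * (1 + entropy ns))"
proof -
  show T: "T = lrm_tree n \<pi>"
    unfolding T_def by (rule result_build_lrm_tree[OF perm])
  obtain p F Qs where pF: "longest_root_path T p F" "list_all2 tree_partition F Qs"
      "mset (map snd ps) = add_mset (tl p) (sum_list Qs)" and ok: "parts_ok ps"
    unfolding ps_def by (rule extract_partition_correct)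
  show part: "lrm_partition n \<pi> (mset (map snd ps))"
    unfolding lrm_partition_def using pF T by blast
  note P = lrm_partition_properties[OF perm n part]
  show \<rho>: "length ns = \<rho>"
    using P(1) by (simp add: ns_def \<rho>_def)
  show sum: "sum_list ns = n"
    using sum_mset_length[OF P(3)] unfolding ns_def
    by (simp add: sum_mset_sum_list flip: mset_map)
  have "ps \<noteq> []" using sum n by (auto simp: ns_def)
  show M: "huffman_tree (mset (map snd ps)) M"
    unfolding M_def by (rule huffman_tree_build[OF ok \<open>ps \<noteq> []\<close>])
  note M' = huffman_tree_sequences[OF M]
  show out: "out = result \<pi> (merge_along M)"
    by (simp add: out_def lrm_sort_def T_def ps_def M_def)
  have "mset out = mset [1..<n + 1]"
    unfolding out mset_merge_along M'(1) by (rule P(3))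
  then show "mset (map \<pi> out) = mset (map \<pi> [1..<n + 1])"
    by (simp only: mset_map)
  show "sorted (map \<pi> out)"
    unfolding out using P(4) M'(1) by (intro sorted_merge_along) simp
  have pos: "0 < k" if "k \<in> set ns" for k using that P(2) by (force simp: ns_def)
  have "ns \<noteq> []" using \<open>ps \<noteq> []\<close> by (simp add: ns_def)
  have "real (join_cost M) \<le> real n * (1 + entropy ns)"
    using join_cost_huffman_tree_le_entropy[OF M] P(2) \<open>ps \<noteq> []\<close> sum unfolding ns_def
    by (metis map_is_Nil_conv set_mset_mset)
  moreover have "comparisons \<pi> (lrm_sort n) \<le> 2 * n + join_cost M"
    using comparisons_build_lrm_tree[of \<pi> n] comparisons_merge_along[OF M'(2), of \<pi>]
    by (simp add: lrm_sort_def T_def[symmetric] ps_def[symmetric] M_def[symmetric])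
  then have "real (comparisons \<pi> (lrm_sort n)) \<le> 2 * real n + real (join_cost M)" by linarith
  ultimately show comps: "real (comparisons \<pi> (lrm_sort n)) \<le> real n * (3 + entropy ns)"
    by (simp add: algebra_simps)
  have "\<rho> \<le> n"
    unfolding \<rho>[symmetric] sum[symmetric] using pos by (induction ns) force+
  have len: "length (labels T) = n + 1"
    unfolding T_def labels_build_lrm_tree by simp
  have "length ps = \<rho>" using \<rho> by (simp add: ns_def)
  have "size (sequences M) = \<rho>" using \<rho> M'(1) by (simp add: ns_def)
  have "internal_ops \<pi> (lrm_sort n) =
      internal_ops \<pi> (build_lrm_tree n) + internal_ops \<pi> (extract_partition T)
      + internal_ops \<pi> (build_huffman_tree ps) + internal_ops \<pi> (merge_along M)"
    by (simp add: lrm_sort_def T_def[symmetric] ps_def[symmetric] M_def[symmetric])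
  moreover have "real (internal_ops \<pi> (build_huffman_tree ps)) \<le>
      14 * real \<rho> + 8 * (real \<rho> * log 2 (real \<rho>)) + 2"
    using internal_ops_build_huffman_tree[OF ok \<open>ps \<noteq> []\<close>, of \<pi>] \<open>length ps = \<rho>\<close>
    by (simp add: mult.assoc)
  moreover have "internal_ops \<pi> (merge_along M) + 2 = 3 * \<rho>"
    using internal_ops_merge_along[of \<pi> M] \<open>size (sequences M) = \<rho>\<close> by simp
  moreover have "0 \<le> real \<rho> * log 2 (real \<rho>)"
    using \<open>ns \<noteq> []\<close> \<rho> by (cases \<rho>) auto
  \<comment> \<open>The terms are at most \<open>5n + 5\<close>, \<open>3n + 2\<close>,
    \<open>14 \<rho> + 8 \<rho> lg \<rho> + 2\<close> and \<open>3 \<rho> - 2\<close>. By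
    \<open>\<rho> \<le> n\<close> and \<open>1 \<le> n\<close> the linear ones sum to at most
    \<open>8n + 17n + 7n = 32n\<close>.\<close>
  ultimately show ops: "real (internal_ops \<pi> (lrm_sort n)) \<le> 32 * (real n + real \<rho> * log 2 (real \<rho>))"
    using internal_ops_build_lrm_tree[of \<pi> n] internal_ops_extract_partition[of \<pi> T] len \<open>\<rho> \<le> n\<close> n
    unfolding distrib_left by linarith
  have log: "real \<rho> * log 2 (real \<rho>) \<le> real n * (1 + entropy ns)"
    using length_log_le_entropy[OF pos \<open>ns \<noteq> []\<close>] unfolding \<rho> sum .
  have "0 \<le> real n * entropy ns"
    using entropy_nonneg[OF pos] by simp
  \<comment> \<open>Here \<open>67 = 3 + 32 + 32\<close>, from the comparisons, the linear term, and
    \<open>\<rho> lg \<rho> \<le> n (1 + H)\<close>. The entropy only has coefficient 33 and is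
    nonnegative.\<close>
  then show "real (total_time \<pi> (lrm_sort n)) \<le> 67 * (real n * (1 + entropy ns))"
    using comps ops log by (simp add: total_time_def algebra_simps)
qed

theorem theorem4:
  "\<exists>C::real. \<forall>(n::nat) (\<pi>::nat \<Rightarrow> nat). 1 \<le> n \<longrightarrow> \<pi> permutes {1..n} \<longrightarrow>
     (let T = result \<pi> (build_lrm_tree n);
          ps = result \<pi> (extract_partition T);
          M = result \<pi> (build_huffman_tree ps);
          out = result \<pi> (lrm_sort n);
          P = map snd ps;
          ns = map length P;
          \<rho> = runs n \<pi>
      in T = lrm_tree n \<pi> \<and>
         lrm_partition n \<pi> (mset P) \<and> length ns = \<rho> \<and> sum_list ns = n \<and>
         huffman_tree (mset P) M \<and>
         out = result \<pi> (merge_along M) \<and>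
         mset (map \<pi> out) = mset (map \<pi> [1..<n + 1]) \<and> sorted (map \<pi> out) \<and>
         real (comparisons \<pi> (lrm_sort n)) \<le> real n * (3 + entropy ns) \<and>
         real (internal_ops \<pi> (lrm_sort n)) \<le> C * (real n + real \<rho> * log 2 (real \<rho>)) \<and>
         real (total_time \<pi> (lrm_sort n)) \<le> C * (real n * (1 + entropy ns)))"
proof (intro exI[of _ 67] allI impI, goal_cases)
  case (1 n \<pi>)
  note spec = lrm_sort_spec[OF this]
  let ?\<rho> = "runs n \<pi>"
  \<comment> \<open>This allows the constant 32 for internal operations to be raised to the 67
    shared with the total time.\<close>
  have "0 \<le> real ?\<rho> * log 2 (real ?\<rho>)" by (simp add: runs_def)
  then have "real (internal_ops \<pi> (lrm_sort n)) \<le> 67 * (real n + real ?\<rho> * log 2 (real ?\<rho>))"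
    using spec(10) by linarith
  with spec show ?case unfolding Let_def by blast
qed

end
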